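(* Let $(X(\cdot),u(\cdot))$, defined on $[0,t_f]$, be an optimal solution of the landing problem (P) described in the context, and let $\Psi$ be the associated switching function. Then the control is in the Max-Min-Max or the Max-Singular-Max form, i.e. there exist $t_1,t_2$ with $0\le t_1\le t_2\le t_f$ such that $\|u(t)\|=u_{max}$ for almost every $t\in[0,t_1)\cup(t_2,t_f]$, and on $[t_1,t_2]$ one of the following holds: either $\|u(t)\|=u_{min}$ for almost every $t\in[t_1,t_2]$, or the control is singular on $[t_1,t_2]$, meaning $\Psi(t)=0$ for all $t\in[t_1,t_2]$.
   Context: Notation. For $p=(p_x,p_y,p_z)\in\mathbb{R}^3$ write $\overline p=(p_x,p_y)$; $e_z=(0,0,1)$; $\mathcal S^d$ is the unit sphere of $\mathbb{R}^{d+1}$. Landing problem (P). Constants: $T>0$, $q\ge 0$, $g_0>0$, $g=(0,0,g_0)$, $m_0>m_e>0$, $0\le u_{min}\le u_{max}\le 1$, $\theta,\gamma\in[0,\pi/2)$, initial data $r_0,v_0\in\mathbb{R}^3$, and a final cost function $\ell(t,X)$. The state is $X=(r,v,m)\in\mathbb{R}^3\times\mathbb{R}^3\times\mathbb{R}$ with $r=(x,y,z)$. Minimize $\ell(t_f,X(t_f))$ over free final times $t_f$ and measurable controls $u:[0,t_f]\to\mathbb{R}^3$ such that $\dot r=v$, $\dot v=\frac{T}{m}u-g$, $\dot m=-q\|u\|$; $(r,v,m)(0)=(r_0,v_0,m_0)$; $z(t_f)=0$, $v_z(t_f)=0$; $m(t)>m_e$ on $[0,t_f)$; $u(t)\in\mathcal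 U=\{w\in\mathbb{R}^3: u_{min}\le\|w\|\le u_{max},\ \langle e_z,w\rangle\ge\|w\|\cos\theta\}$; and the glide-slope constraint $h(r(t))\ge0$, where $h(r)=z-\tan(\gamma)\|\overline r\|$. Set $n(t)=\nabla h(r(t))=\left(-\tan(\gamma)\frac{\overline r(t)}{\|\overline r(t)\|},1\right)$. Adjoint vector. Let $H(X,P,u,p^0)=\langle p_r,v\rangle+\langle p_v,\frac{T}{m}u-g\rangle-p_mq\|u\|$. An optimal solution on $[0,t_f]$ comes with multipliers given by the Pontryagin maximum principle: $p^0\in\{0,-1\}$, an absolutely continuous $P=(p_r,p_v,p_m):[0,t_f]\to\mathbb{R}^3\times\mathbb{R}^3\times\mathbb{R}$ and a nonnegative Borel measure $\mu$ on $[0,t_f]$ such that, with $q_r(t)=p_r(t)-\int_{[0,t)}n(s)\,\mu(ds)$ and $Q=(q_r,p_v,p_m)$: (1) $(P,p^0,\mu)\ne(0,0,0)$; (2) $\mathrm{supp}\,\mu\subset\{t:h(r(t))=0\}$; (3) for a.e. $t$: $\dot p_r=0$, $\dot p_v=-q_r$, $\dot p_m=\frac{T}{m^2}\langle p_v,u\rangle$; (4) for a.e. $t$: $H(X(t),Q(t),u(t),p^0)=\max_{w\in\mathcal U}H(X(t),Q(t),w,p^0)$; (5) $\max_{w\in\mathcal U}H(X(t_f),Q(t_f),w,p^0)=-p^0\frac{\partial\ell}{\partial t}(t_f,X(t_f))$. Direction and switching function. $d:[0,t_f]\to\mathcal S^2$ is a measurable function with $u(t)=\|u(t)\|d(t)$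 whenever $u(t)\neq0$ and $d(t)=\frac{p_v(t)}{\|p_v(t)\|}$ if $p_{v_z}(t)\ge\|p_v(t)\|\cos\theta$ and $p_v(t)\ne0$; $d(t)=\left(\sin\theta\,\frac{\overline p_v(t)}{\|\overline p_v(t)\|},\cos\theta\right)$ if $p_{v_z}(t)<\|p_v(t)\|\cos\theta$ and $\overline p_v(t)\ne0$; $d(t)=(\sin\theta\,\delta,\cos\theta)$ for some $\delta\in\mathcal S^1$ if $p_{v_z}(t)<\|p_v(t)\|\cos\theta$ and $\overline p_v(t)=0$. The switching function is $\Psi(t)=\frac{T}{m(t)}\langle p_v(t),d(t)\rangle-p_m(t)q$. *)

theory Defs
  imports "HOL-Analysis.Analysis"
begin

definition hor :: "real^3 \<Rightarrow> real^2"
  where "hor p = vector [p $ 1, p $ 2]"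

definition vec3 :: "real^2 \<Rightarrow> real \<Rightarrow> real^3"
  where "vec3 w z = vector [w $ 1, w $ 2, z]"

definition e_z :: "real^3"
  where "e_z = vector [0, 0, 1]"

text \<open>The library constant \<open>absolutely_continuous\<close> is about measures.  A pair \<open>(x, y)\<close> in
  the set \<open>A\<close> below stands for the interval from \<open>x\<close> to \<open>y\<close>.\<close>

definition abs_continuous_on :: "real \<Rightarrow> real \<Rightarrow> (real \<Rightarrow> 'a::real_normed_vector) \<Rightarrow> bool"
  where "abs_continuous_on a b f \<longleftrightarrow>
    (\<forall>\<epsilon>>0. \<exists>\<delta>>0. \<forall>A :: (real \<times> real) set.
       finite A \<and> (\<forall>(x, y)\<in>A. a \<le> x \<and> x \<le> y \<and> y \<le> b) \<and>
       disjoint_family_on (\<lambda>(x, y). {x<..<y}) A \<and> (\<Sum>(x, y)\<in>A. y - x) < \<delta>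
       \<longrightarrow> (\<Sum>(x, y)\<in>A. norm (f y - f x)) < \<epsilon>)"

definition measure_support :: "'a::topological_space measure \<Rightarrow> 'a set"
  where "measure_support M =
    {x \<in> space M. \<forall>U. open U \<and> x \<in> U \<longrightarrow> emeasure M (U \<inter> space M) > 0}"

text \<open>The state \<open>X = (r, v, m)\<close> consists of position, velocity and mass; the same type is used
  for the adjoint vectors \<open>(p_r, p_v, p_m)\<close>.\<close>

type_synonym state = "(real^3) \<times> (real^3) \<times> real"

record landing =
  lp_T :: real
  lp_q :: real
  lp_g0 :: real
  lp_m0 :: real
  lp_me :: real
  lp_umin :: real
  lp_umax :: real
  lp_theta :: real
  lp_gamma :: real
  lp_r0 :: "real^3"
  lp_v0 :: "real^3"
  lp_cost :: "real \<Rightarrow> state \<Rightarrow> real"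

definition landing_data :: "landing \<Rightarrow> bool"
  where "landing_data L \<longleftrightarrow>
    lp_T L > 0 \<and> lp_q L \<ge> 0 \<and> lp_g0 L > 0 \<and> lp_m0 L > lp_me L \<and> lp_me L > 0 \<and>
    0 \<le> lp_umin L \<and> lp_umin L \<le> lp_umax L \<and> lp_umax L \<le> 1 \<and>
    lp_theta L \<in> {0..<pi/2} \<and> lp_gamma L \<in> {0..<pi/2}"

definition gravity :: "landing \<Rightarrow> real^3"
  where "gravity L = vector [0, 0, lp_g0 L]"

definition control_set :: "landing \<Rightarrow> (real^3) set"
  where "control_set L =
    {w. lp_umin L \<le> norm w \<and> norm w \<le> lp_umax L \<and> e_z \<bullet> w \<ge> norm w * cos (lp_theta L)}"

definition glide_slope :: "landing \<Rightarrow> real^3 \<Rightarrow> real"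
  where "glide_slope L r = r $ 3 - tan (lp_gamma L) * norm (hor r)"

text \<open>The gradient of \<open>glide_slope L\<close>.  It is not defined at points with \<open>hor r = 0\<close> when
  \<open>\<gamma> > 0\<close>; there the convention \<open>x / 0 = 0\<close> selects the Clarke subgradient \<open>e_z\<close>.  For
  \<open>\<gamma> = 0\<close> the value is \<open>e_z\<close> everywhere, which is the true gradient.\<close>

definition glide_normal :: "landing \<Rightarrow> real^3 \<Rightarrow> real^3"
  where "glide_normal L r = vec3 (- tan (lp_gamma L) *\<^sub>R (hor r /\<^sub>R norm (hor r))) 1"

text \<open>Trajectories are Caratheodory solutions: absolutely continuous, with the differential
  equations holding almost everywhere.\<close>

definition admissible ::
    "landing \<Rightarrow> real \<Rightarrow> (real \<Rightarrow> real^3) \<Rightarrow> (real \<Rightarrow> real^3) \<Rightarrow> (real \<Rightarrow> real) \<Rightarrow> (real \<Rightarrow> real^3) \<Rightarrow> bool"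
  where "admissible L tf r v m u \<longleftrightarrow>
    tf \<ge> 0 \<and>
    u \<in> borel_measurable (lebesgue_on {0..tf}) \<and>
    abs_continuous_on 0 tf r \<and> abs_continuous_on 0 tf v \<and> abs_continuous_on 0 tf m \<and>
    (AE t\<in>{0..tf} in lebesgue.
       (r has_vector_derivative v t) (at t within {0..tf}) \<and>
       (v has_vector_derivative ((lp_T L / m t) *\<^sub>R u t - gravity L)) (at t within {0..tf}) \<and>
       (m has_real_derivative (- lp_q L * norm (u t))) (at t within {0..tf})) \<and>
    r 0 = lp_r0 L \<and> v 0 = lp_v0 L \<and> m 0 = lp_m0 L \<and>
    r tf $ 3 = 0 \<and> v tf $ 3 = 0 \<and>
    (\<forall>t\<in>{0..<tf}. m t > lp_me L) \<and>
    (\<forall>t\<in>{0..tf}. u t \<in> control_set L) \<and>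
    (\<forall>t\<in>{0..tf}. glide_slope L (r t) \<ge> 0)"

definition optimal ::
    "landing \<Rightarrow> real \<Rightarrow> (real \<Rightarrow> real^3) \<Rightarrow> (real \<Rightarrow> real^3) \<Rightarrow> (real \<Rightarrow> real) \<Rightarrow> (real \<Rightarrow> real^3) \<Rightarrow> bool"
  where "optimal L tf r v m u \<longleftrightarrow>
    admissible L tf r v m u \<and>
    (\<forall>tf' r' v' m' u'. admissible L tf' r' v' m' u' \<longrightarrow>
       lp_cost L tf (r tf, v tf, m tf) \<le> lp_cost L tf' (r' tf', v' tf', m' tf'))"

text \<open>The argument \<open>p0\<close> does not occur on the right-hand side: the problem has no running cost.\<close>

fun hamiltonian :: "landing \<Rightarrow> state \<Rightarrow> state \<Rightarrow> real^3 \<Rightarrow> real \<Rightarrow> real"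
  where "hamiltonian L (r, v, m) (pr, pv, pm) w p0 =
    pr \<bullet> v + pv \<bullet> ((lp_T L / m) *\<^sub>R w - gravity L) - pm * lp_q L * norm w"

definition adjoint_q ::
    "landing \<Rightarrow> (real \<Rightarrow> real^3) \<Rightarrow> (real \<Rightarrow> real^3) \<Rightarrow> real measure \<Rightarrow> real \<Rightarrow> real^3"
  where "adjoint_q L r pr \<mu> t = pr t - (LINT s:{0..<t}|\<mu>. glide_normal L (r s))"

text \<open>Since \<open>control_set L\<close> is compact and nonempty and the Hamiltonian is continuous in the
  control, the suprema below are maxima.\<close>

definition pmp_multipliers ::
    "landing \<Rightarrow> real \<Rightarrow> (real \<Rightarrow> real^3) \<Rightarrow> (real \<Rightarrow> real^3) \<Rightarrow> (real \<Rightarrow> real) \<Rightarrow> (real \<Rightarrow> real^3) \<Rightarrow>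
     real \<Rightarrow> (real \<Rightarrow> real^3) \<Rightarrow> (real \<Rightarrow> real^3) \<Rightarrow> (real \<Rightarrow> real) \<Rightarrow> real measure \<Rightarrow> bool"
  where "pmp_multipliers L tf r v m u p0 pr pv pm \<mu> \<longleftrightarrow>
    p0 \<in> {0, -1} \<and>
    abs_continuous_on 0 tf pr \<and> abs_continuous_on 0 tf pv \<and> abs_continuous_on 0 tf pm \<and>
    sets \<mu> = sets (restrict_space borel {0..tf}) \<and> finite_measure \<mu> \<and>
    \<not> ((\<forall>t\<in>{0..tf}. pr t = 0 \<and> pv t = 0 \<and> pm t = 0) \<and> p0 = 0 \<and> emeasure \<mu> (space \<mu>) = 0) \<and>
    measure_support \<mu> \<subseteq> {t \<in> {0..tf}. glide_slope L (r t) = 0} \<and>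
    (AE t\<in>{0..tf} in lebesgue.
       (pr has_vector_derivative 0) (at t within {0..tf}) \<and>
       (pv has_vector_derivative (- adjoint_q L r pr \<mu> t)) (at t within {0..tf}) \<and>
       (pm has_real_derivative (lp_T L / (m t)\<^sup>2 * (pv t \<bullet> u t))) (at t within {0..tf})) \<and>
    (AE t\<in>{0..tf} in lebesgue.
       hamiltonian L (r t, v t, m t) (adjoint_q L r pr \<mu> t, pv t, pm t) (u t) p0 =
       (SUP w\<in>control_set L.
          hamiltonian L (r t, v t, m t) (adjoint_q L r pr \<mu> t, pv t, pm t) w p0)) \<and>
    (\<exists>D. ((\<lambda>t. lp_cost L t (r tf, v tf, m tf)) has_real_derivative D) (at tf) \<and>
       (SUP w\<in>control_set L.
          hamiltonian L (r tf, v tf, m tf) (adjoint_q L r pr \<mu> tf, pv tf, pm tf) w p0) = - p0 * D)"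

text \<open>Where \<open>pv t = 0\<close> none of the three cases applies, and \<open>d t\<close> is any unit vector that is
  compatible with \<open>u t\<close>.\<close>

definition thrust_direction ::
    "landing \<Rightarrow> real \<Rightarrow> (real \<Rightarrow> real^3) \<Rightarrow> (real \<Rightarrow> real^3) \<Rightarrow> (real \<Rightarrow> real^3) \<Rightarrow> bool"
  where "thrust_direction L tf u pv d \<longleftrightarrow>
    d \<in> borel_measurable (lebesgue_on {0..tf}) \<and>
    (\<forall>t\<in>{0..tf}.
       d t \<in> sphere 0 1 \<and>
       (u t \<noteq> 0 \<longrightarrow> u t = norm (u t) *\<^sub>R d t) \<and>
       (pv t $ 3 \<ge> norm (pv t) * cos (lp_theta L) \<and> pv t \<noteq> 0 \<longrightarrow>
          d t = pv t /\<^sub>R norm (pv t)) \<and>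
       (pv t $ 3 < norm (pv t) * cos (lp_theta L) \<and> hor (pv t) \<noteq> 0 \<longrightarrow>
          d t = vec3 (sin (lp_theta L) *\<^sub>R (hor (pv t) /\<^sub>R norm (hor (pv t)))) (cos (lp_theta L))) \<and>
       (pv t $ 3 < norm (pv t) * cos (lp_theta L) \<and> hor (pv t) = 0 \<longrightarrow>
          (\<exists>\<delta>\<in>sphere 0 1. d t = vec3 (sin (lp_theta L) *\<^sub>R \<delta>) (cos (lp_theta L)))))"

definition switching_function ::
    "landing \<Rightarrow> (real \<Rightarrow> real) \<Rightarrow> (real \<Rightarrow> real^3) \<Rightarrow> (real \<Rightarrow> real) \<Rightarrow> (real \<Rightarrow> real^3) \<Rightarrow> real \<Rightarrow> real"
  where "switching_function L m pv pm d t = lp_T L / m t * (pv t \<bullet> d t) - pm t * lp_q L"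

end

theory Submission
  imports Defs
begin

text \<open>The thrust direction maximizes \<open>w \<mapsto> p_v \<bullet> w\<close> over a spherical cap with support function \<open>\<phi>\<close>, and
  the mass terms cancel in the derivative of the switching function, leaving
  \<open>\<Psi>' = (T / m) * F'\<close> with \<open>F = \<phi> \<circ> p_v\<close>.  The point is that \<open>F\<close> is convex.  Formally
  \<open>p_v'' = n \<mu>\<close>, so \<open>F\<close> has a local affine support at \<open>t\<close> as soon as some convex combination \<open>w\<close> of
  maximizing directions at \<open>t\<close> satisfies \<open>n \<bullet> w \<ge> 0\<close> \<open>\<mu>\<close>-almost everywhere near \<open>t\<close>.  Away from contact
  \<open>\<mu>\<close> vanishes; where the maximizing direction jumps one takes \<open>w\<close> vertical; and at the remaining
  contact points the dynamics force \<open>n \<bullet> d > 0\<close>, since otherwise the distance to the cone would be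
  strictly concave near a zero minimum.  Hence \<open>\<Psi>\<close> decreases and then increases, strictly so
  wherever \<open>F\<close> is not minimal, and the maximum condition reads off \<open>norm u\<close> from the sign of \<open>\<Psi>\<close>.\<close>

subsection \<open>Absolutely continuous functions\<close>

text \<open>The obstacle is regularity. The derivative of \<open>pv\<close> may jump at atoms of
  \<mu>, \<open>d\<close> may jump where \<open>pv\<close> vanishes or points straight down, and the
  normal jumps at the apex of the cone. Convexity of \<open>F\<close> is therefore tested only
  through the minorants \<open>pv s \<bullet> w\<close> with \<open>w\<close> in the convex hull of
  the cap: they touch \<open>F\<close> at \<open>t\<close>, and their derivative
  \<open>- (q_r \<bullet> w)\<close> is nondecreasing wherever the normals have nonnegative product
  with \<open>w\<close>. Convex combinations are essential: where \<open>pv\<close> points straight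
  down the maximizers fill a circle and no single one need satisfy the sign condition, whereas the
  centre of the circle does. The two forms of the control correspond to the value of the minimum of
  \<Psi>. On the set where \<open>F\<close> is minimal \<Psi> is constant and minimal, and off it
  \<Psi> is strictly monotone on each side. So \<Psi> can vanish on a nondegenerate interval only if
  its minimum is zero.\<close>

text \<open>A single transfer principle from which inner products, linear combinations and
  reciprocals all inherit absolute continuity.\<close>

lemma abs_continuous_on_dominated:
  fixes f :: "real \<Rightarrow> 'a::real_normed_vector" and g :: "real \<Rightarrow> 'b::real_normed_vector"
    and h :: "real \<Rightarrow> 'c::real_normed_vector"
  assumes f: "abs_continuous_on a b f" and g: "abs_continuous_on a b g"
    and le: "\<And>x y. a \<le> x \<Longrightarrow> x \<le> y \<Longrightarrow> y \<le> b \<Longrightarrow>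
      norm (h y - h x) \<le> C * norm (f y - f x) + C * norm (g y - g x)"
  shows "abs_continuous_on a b h"
  unfolding abs_continuous_on_def
proof (intro allI impI)
  fix \<epsilon> :: real assume "\<epsilon> > 0"
  \<comment> \<open>No sign is assumed for \<open>C\<close>; enlarging it to a positive constant
    allows division by it.\<close>
  define C' where "C' = max C 1"
  have C': "C' > 0" "C \<le> C'" by (auto simp: C'_def)
  have le': "norm (h y - h x) \<le> C' * norm (f y - f x) + C' * norm (g y - g x)"
    if "a \<le> x" "x \<le> y" "y \<le> b" for x y
    using le[OF that] mult_right_mono[OF C'(2), of "norm (f y - f x)"]
      mult_right_mono[OF C'(2), of "norm (g y - g x)"] by auto
  have e: "\<epsilon> / (2 * C') > 0" using \<open>\<epsilon> > 0\<close> C' by simp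
  obtain \<delta>1 where \<delta>1: "\<delta>1 > 0" "\<forall>A :: (real \<times> real) set.
       finite A \<and> (\<forall>(x, y)\<in>A. a \<le> x \<and> x \<le> y \<and> y \<le> b) \<and>
       disjoint_family_on (\<lambda>(x, y). {x<..<y}) A \<and> (\<Sum>(x, y)\<in>A. y - x) < \<delta>1
       \<longrightarrow> (\<Sum>(x, y)\<in>A. norm (f y - f x)) < \<epsilon> / (2 * C')"
    using f e unfolding abs_continuous_on_def by meson
  obtain \<delta>2 where \<delta>2: "\<delta>2 > 0" "\<forall>A :: (real \<times> real) set.
       finite A \<and> (\<forall>(x, y)\<in>A. a \<le> x \<and> x \<le> y \<and> y \<le> b) \<and>
       disjoint_family_on (\<lambda>(x, y). {x<..<y}) A \<and> (\<Sum>(x, y)\<in>A. y - x) < \<delta>2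
       \<longrightarrow> (\<Sum>(x, y)\<in>A. norm (g y - g x)) < \<epsilon> / (2 * C')"
    using g e unfolding abs_continuous_on_def by meson
  show "\<exists>\<delta>>0. \<forall>A :: (real \<times> real) set.
       finite A \<and> (\<forall>(x, y)\<in>A. a \<le> x \<and> x \<le> y \<and> y \<le> b) \<and>
       disjoint_family_on (\<lambda>(x, y). {x<..<y}) A \<and> (\<Sum>(x, y)\<in>A. y - x) < \<delta>
       \<longrightarrow> (\<Sum>(x, y)\<in>A. norm (h y - h x)) < \<epsilon>"
  proof (intro exI conjI allI impI)
    show "min \<delta>1 \<delta>2 > 0" using \<delta>1 \<delta>2 by simp
    fix A :: "(real \<times> real) set"
    assume A: "finite A \<and> (\<forall>(x, y)\<in>A. a \<le> x \<and> x \<le> y \<and> y \<le> b) \<and>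
       disjoint_family_on (\<lambda>(x, y). {x<..<y}) A \<and> (\<Sum>(x, y)\<in>A. y - x) < min \<delta>1 \<delta>2"
    have "(\<Sum>(x, y)\<in>A. norm (h y - h x))
        \<le> (\<Sum>(x, y)\<in>A. C' * norm (f y - f x) + C' * norm (g y - g x))"
      using A le' by (intro sum_mono) auto
    also have "\<dots> = C' * (\<Sum>(x, y)\<in>A. norm (f y - f x)) + C' * (\<Sum>(x, y)\<in>A. norm (g y - g x))"
      by (simp add: case_prod_unfold sum.distrib sum_distrib_left)
    also have "\<dots> < C' * (\<epsilon> / (2 * C')) + C' * (\<epsilon> / (2 * C'))"
      using \<delta>1(2) \<delta>2(2) A C' by (intro add_strict_mono mult_strict_left_mono) auto
    also have "\<dots> = \<epsilon>" using C' by (simp add: field_simps)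
    finally show "(\<Sum>(x, y)\<in>A. norm (h y - h x)) < \<epsilon>" .
  qed
qed

lemma abs_continuous_on_subinterval:
  assumes "abs_continuous_on a b f" "a \<le> a'" "b' \<le> b"
  shows "abs_continuous_on a' b' f"
  unfolding abs_continuous_on_def
proof (intro allI impI)
  fix \<epsilon> :: real assume "\<epsilon> > 0"
  then obtain \<delta> where \<delta>: "\<delta> > 0" "\<forall>A :: (real \<times> real) set.
       finite A \<and> (\<forall>(x, y)\<in>A. a \<le> x \<and> x \<le> y \<and> y \<le> b) \<and>
       disjoint_family_on (\<lambda>(x, y). {x<..<y}) A \<and> (\<Sum>(x, y)\<in>A. y - x) < \<delta>
       \<longrightarrow> (\<Sum>(x, y)\<in>A. norm (f y - f x)) < \<epsilon>"
    using assms(1) unfolding abs_continuous_on_def by meson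
  show "\<exists>\<delta>>0. \<forall>A :: (real \<times> real) set.
       finite A \<and> (\<forall>(x, y)\<in>A. a' \<le> x \<and> x \<le> y \<and> y \<le> b') \<and>
       disjoint_family_on (\<lambda>(x, y). {x<..<y}) A \<and> (\<Sum>(x, y)\<in>A. y - x) < \<delta>
       \<longrightarrow> (\<Sum>(x, y)\<in>A. norm (f y - f x)) < \<epsilon>"
    using \<delta> assms(2,3) by (intro exI[of _ \<delta>]) fastforce
qed

lemma abs_continuous_on_imp_continuous_on:
  fixes f :: "real \<Rightarrow> 'a::real_normed_vector"
  assumes "abs_continuous_on a b f"
  shows "continuous_on {a..b} f"
  unfolding continuous_on_iff
proof (intro ballI allI impI)
  fix x and \<epsilon> :: real assume x: "x \<in> {a..b}" and "\<epsilon> > 0"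
  then obtain \<delta> where \<delta>: "\<delta> > 0" "\<And>A :: (real \<times> real) set.
       finite A \<and> (\<forall>(x, y)\<in>A. a \<le> x \<and> x \<le> y \<and> y \<le> b) \<and>
       disjoint_family_on (\<lambda>(x, y). {x<..<y}) A \<and> (\<Sum>(x, y)\<in>A. y - x) < \<delta>
       \<Longrightarrow> (\<Sum>(x, y)\<in>A. norm (f y - f x)) < \<epsilon>"
    using assms unfolding abs_continuous_on_def by meson
  show "\<exists>\<delta>>0. \<forall>x'\<in>{a..b}. dist x' x < \<delta> \<longrightarrow> dist (f x') (f x) < \<epsilon>"
  proof (intro exI conjI ballI impI)
    fix y assume y: "y \<in> {a..b}" "dist y x < \<delta>"
    \<comment> \<open>The definition tests only pairs with ordered endpoints, so the one-interval
      family is built from the sorted pair.\<close>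
    have "norm (f (max x y) - f (min x y)) < \<epsilon>"
      using \<delta>(2)[of "{(min x y, max x y)}"] x y
      by (auto simp: disjoint_family_on_def dist_real_def min_def max_def split: if_splits)
    then show "dist (f y) (f x) < \<epsilon>"
      by (auto simp: dist_norm min_def max_def norm_minus_commute split: if_splits)
  qed (fact \<delta>)
qed

text \<open>In a sufficiently fine tagged division, the intervals tagged in the exceptional null set lie in
  an open set of small measure and contribute little by absolute continuity, and on all others the
  increment is almost nonnegative.\<close>

lemma abs_continuous_on_AE_deriv_nonneg:
  fixes f :: "real \<Rightarrow> real"
  assumes ac: "abs_continuous_on a b f" and ab: "a \<le> b"
    and ae: "AE x in lebesgue. x \<in> {a..b} \<longrightarrow>
      (\<exists>D\<ge>0. (f has_real_derivative D) (at x within {a..b}))"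
  shows "f a \<le> f b"
proof -
  \<comment> \<open>The summand \<open>b - a\<close> collects the errors of the well-tagged
    intervals, the summand 1 those of the exceptional ones.\<close>
  have "f b - f a \<ge> - \<epsilon> * (b - a + 1)" if "\<epsilon> > 0" for \<epsilon>
  proof -
    obtain \<delta> where \<delta>: "\<delta> > 0" "\<And>A :: (real \<times> real) set.
       finite A \<Longrightarrow> (\<forall>(x, y)\<in>A. a \<le> x \<and> x \<le> y \<and> y \<le> b) \<Longrightarrow>
       disjoint_family_on (\<lambda>(x, y). {x<..<y}) A \<Longrightarrow> (\<Sum>(x, y)\<in>A. y - x) < \<delta>
       \<Longrightarrow> (\<Sum>(x, y)\<in>A. norm (f y - f x)) < \<epsilon>"
      using ac \<open>\<epsilon> > 0\<close> unfolding abs_continuous_on_def by meson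
    obtain N where N: "N \<in> null_sets lebesgue"
      "\<And>x. x \<in> {a..b} \<Longrightarrow> x \<notin> N \<Longrightarrow> \<exists>D\<ge>0. (f has_real_derivative D) (at x within {a..b})"
    proof -
      obtain N where "N \<in> null_sets lebesgue"
        "{x \<in> space lebesgue. \<not> (x \<in> {a..b} \<longrightarrow>
          (\<exists>D\<ge>0. (f has_real_derivative D) (at x within {a..b})))} \<subseteq> N"
        using ae unfolding eventually_ae_filter by blast
      then show thesis by (intro that[of N]) auto
    qed
    obtain U where U: "open U" "N \<subseteq> U" "U \<in> lmeasurable" "measure lebesgue U < \<delta>"
    proof -
      have Ns: "N \<in> sets lebesgue" using N by auto
      obtain T where T: "open T" "N \<subseteq> T" "T - N \<in> lmeasurable" "emeasure lebesgue (T - N) < ennreal \<delta>"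
        using sets_lebesgue_outer_open[OF Ns \<delta>(1)] by metis
      have "emeasure lebesgue T \<le> emeasure lebesgue (T - N)"
      proof -
        have "T = (T - N) \<union> N" using T by auto
        moreover have "emeasure lebesgue ((T - N) \<union> N) = emeasure lebesgue (T - N)"
          using T N by (intro emeasure_Un_null_set) auto
        ultimately show ?thesis by simp
      qed
      then have "emeasure lebesgue T < ennreal \<delta>" using T by simp
      moreover have "T \<in> sets lebesgue" using T(1) by auto
      ultimately have "T \<in> lmeasurable"
        by (auto simp: fmeasurable_def intro: order_less_trans[of _ "ennreal \<delta>"])
      with \<open>emeasure lebesgue T < ennreal \<delta>\<close> have "measure lebesgue T < \<delta>"
        by (simp add: emeasure_eq_measure2 ennreal_less_iff)
      with \<open>T \<in> lmeasurable\<close>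
show ?thesis using that T by blast
    qed
    \<comment> \<open>The radius defines the gauge. The factor \<open>sgn (y - x)\<close> treats the
      parts of an interval to the left and to the right of its tag by one inequality.\<close>
    have "\<exists>e>0. (x \<in> N \<longrightarrow> ball x e \<subseteq> U) \<and>
        (x \<in> {a..b} - N \<longrightarrow> (\<forall>y\<in>{a..b}. \<bar>y - x\<bar> < e \<longrightarrow>
           (f y - f x) * sgn (y - x) \<ge> - \<epsilon> * \<bar>y - x\<bar>))" for x
    proof (cases "x \<in> N")
      case True
      then obtain e where "e > 0" "ball x e \<subseteq> U" using U by (meson open_contains_ball subsetD)
      then show ?thesis using True by auto
    next
      case False
      show ?thesis
      proof (cases "x \<in> {a..b}")
        case True
        then obtain D where D: "D \<ge> 0" "(f has_derivative (\<lambda>y. y * D)) (at x within {a..b})"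
          using N(2) False unfolding has_field_derivative_def
          by (metis (no_types, lifting) mult.commute ext)
        then obtain e where e: "e > 0" "\<And>y. y \<in> {a..b} \<Longrightarrow> norm (y - x) < e \<Longrightarrow>
            norm (f y - f x - (y - x) * D) \<le> \<epsilon> * norm (y - x)"
          using \<open>\<epsilon> > 0\<close> unfolding has_derivative_within_alt by metis
        have "(f y - f x) * sgn (y - x) \<ge> - \<epsilon> * \<bar>y - x\<bar>"
          if y: "y \<in> {a..b}" "\<bar>y - x\<bar> < e" for y
        proof -
          have *: "\<bar>f y - f x - (y - x) * D\<bar> \<le> \<epsilon> * \<bar>y - x\<bar>" using e(2)[of y] y by simp
          consider "y > x" | "y = x" | "y < x" by linarith
          then show ?thesis
          proof cases
            case 1
            then have "(y - x) * D \<ge> 0" using D by simp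
            then show ?thesis using * 1 by (simp add: abs_le_iff)
          next
            case 3
            then have "(y - x) * D \<le> 0" using D by (simp add: mult_nonpos_nonneg)
            then show ?thesis using * 3 by (simp add: abs_le_iff)
          qed auto
        qed
        then show ?thesis using e False by auto
      qed (use False in \<open>auto intro: exI[of _ 1]\<close>)
    qed
    then obtain e where e: "\<And>x. e x > 0" "\<And>x. x \<in> N \<Longrightarrow> ball x (e x) \<subseteq> U"
      "\<And>x y. x \<in> {a..b} - N \<Longrightarrow> y \<in> {a..b} \<Longrightarrow> \<bar>y - x\<bar> < e x \<Longrightarrow>
           (f y - f x) * sgn (y - x) \<ge> - \<epsilon> * \<bar>y - x\<bar>" by metis
    have "gauge (\<lambda>x. ball x (e x))" using e(1) by (auto simp: gauge_def)
    then obtain p where p: "p tagged_division_of {a..b}" "(\<lambda>x. ball x (e x)) fine p"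
      using fine_division_exists_real by blast
    note pD = tagged_division_ofD[OF p(1)]
    have pI: "\<exists>s t. K = {s..t} \<and> s \<le> x \<and> x \<le> t \<and> a \<le> s \<and> t \<le> b \<and> Inf K = s \<and> Sup K = t
        \<and> {s..t} \<subseteq> ball x (e x)"
      if xK: "(x, K) \<in> p" for x K
    proof -
      obtain s t where "K = {s..t}" using pD(4)[OF xK] by auto
      moreover have "x \<in> K" "K \<subseteq> {a..b}" using pD(2,3)[OF xK] by auto
      moreover have "K \<subseteq> ball x (e x)" using p(2) xK by (auto simp: fine_def)
      ultimately show ?thesis by (intro exI[of _ s] exI[of _ t]) auto
    qed
    define B where "B = {(x, K) \<in> p. x \<in> N}"
    have finB: "finite B" "finite p" "B \<subseteq> p"
      using pD(1) by (auto simp: B_def intro: finite_subset)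
    have good: "(\<Sum>(x, K)\<in>p - B. f (Sup K) - f (Inf K)) \<ge> - \<epsilon> * (b - a)"
    proof -
      have "- \<epsilon> * (b - a) \<le> - \<epsilon> * (\<Sum>(x, K)\<in>p - B. Sup K - Inf K)"
      proof -
        have "(\<Sum>(x, K)\<in>p - B. Sup K - Inf K) \<le> (\<Sum>(x, K)\<in>p. Sup K - Inf K)"
          using finB pI by (intro sum_mono2) force+
        also have "\<dots> = b - a" using additive_tagged_division_1[OF ab p(1), of "\<lambda>x. x"] by simp
        finally show ?thesis using \<open>\<epsilon> > 0\<close> by simp
      qed
      also have "\<dots> = (\<Sum>(x, K)\<in>p - B. - \<epsilon> * (Sup K - Inf K))"
        by (simp add: sum_distrib_left case_prod_unfold)
      also have "\<dots> \<le> (\<Sum>(x, K)\<in>p - B. f (Sup K) - f (Inf K))"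
      proof (rule sum_mono, clarify)
        fix x K assume xK: "(x, K) \<in> p" "(x, K) \<notin> B"
        obtain s t where st: "s \<le> x" "x \<le> t" "a \<le> s" "t \<le> b" "Inf K = s" "Sup K = t"
          "{s..t} \<subseteq> ball x (e x)" using pI[OF xK(1)] by blast
        have x: "x \<in> {a..b} - N" using xK st by (auto simp: B_def)
        have bs: "\<bar>s - x\<bar> < e x" "\<bar>t - x\<bar> < e x"
          using subsetD[OF st(7), of s] subsetD[OF st(7), of t] st(1,2)
          by (simp_all add: dist_real_def abs_minus_commute)
        have "(f t - f x) * sgn (t - x) \<ge> - \<epsilon> * \<bar>t - x\<bar>" "(f s - f x) * sgn (s - x) \<ge> - \<epsilon> * \<bar>s - x\<bar>"
          using e(3)[OF x _ bs(2)] e(3)[OF x _ bs(1)] st(1-4) by simp_all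
        then have "f t - f x \<ge> - \<epsilon> * (t - x)" "f x - f s \<ge> - \<epsilon> * (x - s)"
          using st(1,2) by (auto simp: sgn_if split: if_splits)
        moreover have "- \<epsilon> * (t - s) = - \<epsilon> * (t - x) + - \<epsilon> * (x - s)" by algebra
        ultimately show "- \<epsilon> * (Sup K - Inf K) \<le> f (Sup K) - f (Inf K)" unfolding st(5,6) by linarith
      qed
      finally show ?thesis .
    qed
    have bad: "(\<Sum>(x, K)\<in>B. \<bar>f (Sup K) - f (Inf K)\<bar>) < \<epsilon>"
    proof -
      define A where "A = (\<lambda>(x :: real, K :: real set). (Inf K, Sup K)) ` B"
      \<comment> \<open>Absolute continuity speaks of a set of endpoint pairs, so forgetting the
        tags may merge intervals. Only degenerate ones can merge, and these contribute zero to the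
        sum.\<close>
      have coll: "Inf K = Sup K" if "(x, K) \<in> B" "(x', K') \<in> B" "(x, K) \<noteq> (x', K')"
        "{Inf K<..<Sup K} \<inter> {Inf K'<..<Sup K'} \<noteq> {} \<or> (Inf K = Inf K' \<and> Sup K = Sup K')" for x K x' K'
      proof -
        have in_p: "(x, K) \<in> p" "(x', K') \<in> p" using that finB by auto
        obtain s t where st: "K = {s..t}" "s \<le> t" "Inf K = s" "Sup K = t" using pI[OF in_p(1)] by force
        obtain s' t' where st': "K' = {s'..t'}" "s' \<le> t'" "Inf K' = s'" "Sup K' = t'" using pI[OF in_p(2)] by force
        have "interior K \<inter> interior K' = {}" using pD(5)[OF in_p that(3)] .
        then have "{s<..<t} \<inter> {s'<..<t'} = {}" using st st' by (simp add: interior_atLeastAtMost_real)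
        then show ?thesis using that(4) st st' by auto
      qed
      have finA: "finite A" using finB by (simp add: A_def)
      have 1: "\<forall>(x, y)\<in>A. a \<le> x \<and> x \<le> y \<and> y \<le> b" using pI finB(3) by (fastforce simp: A_def)
      have 2: "disjoint_family_on (\<lambda>(x, y). {x<..<y}) A"
        unfolding disjoint_family_on_def
      proof (intro ballI impI)
        fix i j assume ij: "i \<in> A" "j \<in> A" "i \<noteq> j"
        then obtain x K x' K' where K: "(x, K) \<in> B" "i = (Inf K, Sup K)"
          "(x', K') \<in> B" "j = (Inf K', Sup K')" by (auto simp: A_def)
        then have "(x, K) \<noteq> (x', K')" using ij by auto
        with coll[OF K(1,3)] K show "(case i of (x, y) \<Rightarrow> {x<..<y}) \<inter> (case j of (x, y) \<Rightarrow> {x<..<y}) = {}"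
          by force
      qed
      have 3: "(\<Sum>(x, y)\<in>A. y - x) < \<delta>"
      proof -
        have "(\<Sum>(x, y)\<in>A. y - x) = (\<Sum>i\<in>A. measure lebesgue (case i of (x, y) \<Rightarrow> {x<..<y}))"
          using 1 by (intro sum.cong) auto
        also have "\<dots> = measure lebesgue (\<Union>i\<in>A. case i of (x, y) \<Rightarrow> {x<..<y})"
          using 2 finA by (intro measure_UNION'[symmetric])
            (auto simp: disjoint_family_on_def pairwise_def disjnt_def)
        also have "\<dots> \<le> measure lebesgue U"
        proof (rule measure_mono_fmeasurable)
          show "(\<Union>i\<in>A. case i of (x, y) \<Rightarrow> {x<..<y}) \<subseteq> U"
          proof clarify
            fix z u v assume "(u, v) \<in> A" "z \<in> {u<..<v}"
            then obtain x K where K: "(x, K) \<in> B" "u = Inf K" "v = Sup K" by (auto simp: A_def)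
            then have "(x, K) \<in> p" "x \<in> N" by (auto simp: B_def)
            with pI[of x K] K \<open>z \<in> {u<..<v}\<close> have "z \<in> ball x (e x)" by force
            then show "z \<in> U" using e(2)[OF \<open>x \<in> N\<close>] by auto
          qed
        qed (use U finA in auto)
        finally show ?thesis using U by simp
      qed
      have "(\<Sum>(x, K)\<in>B. \<bar>f (Sup K) - f (Inf K)\<bar>) = (\<Sum>(x, y)\<in>A. norm (f y - f x))"
        unfolding A_def
      proof (subst sum.reindex_nontrivial[OF finB(1)])
        fix i j assume "i \<in> B" "j \<in> B" "i \<noteq> j"
          "(case i of (x, K) \<Rightarrow> (Inf K, Sup K)) = (case j of (x, K) \<Rightarrow> (Inf K, Sup K))"
        then show "(case case i of (x, K) \<Rightarrow> (Inf K, Sup K) of (x, y) \<Rightarrow> norm (f y - f x)) = 0"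
          using coll by (cases i, cases j) force
      qed (auto simp: case_prod_unfold comp_def)
      also have "\<dots> < \<epsilon>" using \<delta>(2)[OF finA 1 2 3] .
      finally show ?thesis .
    qed
    have "f b - f a = (\<Sum>(x, K)\<in>p. f (Sup K) - f (Inf K))"
      using additive_tagged_division_1[OF ab p(1), of f] by simp
    also have "\<dots> = (\<Sum>(x, K)\<in>p - B. f (Sup K) - f (Inf K)) + (\<Sum>(x, K)\<in>B. f (Sup K) - f (Inf K))"
      by (rule sum.subset_diff[OF finB(3,2)])
    also have "(\<Sum>(x, K)\<in>B. f (Sup K) - f (Inf K)) \<ge> - (\<Sum>(x, K)\<in>B. \<bar>f (Sup K) - f (Inf K)\<bar>)"
      unfolding sum_negf[symmetric] by (intro sum_mono) auto
    ultimately have "f b - f a \<ge> - \<epsilon> * (b - a) - \<epsilon>" using good bad by linarith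
    then show ?thesis by (simp add: algebra_simps)
  qed
  then have *: "f a - f b \<le> \<epsilon> * (b - a + 1)" if "\<epsilon> > 0" for \<epsilon> using that by force
  show ?thesis
  proof (rule ccontr)
    assume "\<not> f a \<le> f b"
    define c where "c = b - a + 1"
    have c: "c > 0" using ab by (simp add: c_def)
    then have "(f a - f b) / (2 * c) > 0" using \<open>\<not> f a \<le> f b\<close> by simp
    from *[OF this] have "f a - f b \<le> (f a - f b) / (2 * c) * c" unfolding c_def .
    also have "\<dots> = (f a - f b) / 2" using c by simp
    finally show False using \<open>\<not> f a \<le> f b\<close> by simp
  qed
qed

section \<open>Closure properties and mean value inequalities\<close>

lemma abs_continuous_on_ident: "abs_continuous_on a b (\<lambda>x. x :: real)"
  unfolding abs_continuous_on_def
proof (intro allI impI)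
  fix \<epsilon> :: real assume "\<epsilon> > 0"
  moreover have "(\<Sum>(x, y)\<in>A. norm (y - x)) = (\<Sum>(x, y)\<in>A. y - x)"
    if "\<forall>(x, y)\<in>A. a \<le> x \<and> x \<le> y \<and> y \<le> b" for A :: "(real \<times> real) set"
    using that by (intro sum.cong) auto
  ultimately show "\<exists>\<delta>>0. \<forall>A :: (real \<times> real) set.
       finite A \<and> (\<forall>(x, y)\<in>A. a \<le> x \<and> x \<le> y \<and> y \<le> b) \<and>
       disjoint_family_on (\<lambda>(x, y). {x<..<y}) A \<and> (\<Sum>(x, y)\<in>A. y - x) < \<delta>
       \<longrightarrow> (\<Sum>(x, y)\<in>A. norm (y - x)) < \<epsilon>"
    by (intro exI[of _ \<epsilon>]) auto
qed

lemma abs_continuous_on_inner_left: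
  fixes f :: "real \<Rightarrow> 'a::real_inner"
  assumes "abs_continuous_on a b f"
  shows "abs_continuous_on a b (\<lambda>t. f t \<bullet> w)"
proof (rule abs_continuous_on_dominated[OF assms assms])
  fix x y :: real
  have "\<bar>f y \<bullet> w - f x \<bullet> w\<bar> \<le> norm w * norm (f y - f x)"
    using Cauchy_Schwarz_ineq2[of "f y - f x" w] by (simp add: inner_diff_left mult.commute)
  moreover have "norm w * norm (f y - f x) \<ge> 0" by simp
  ultimately show "norm (f y \<bullet> w - f x \<bullet> w) \<le> norm w * norm (f y - f x) + norm w * norm (f y - f x)"
    by simp
qed

lemma abs_continuous_on_linear_combination:
  fixes f g :: "real \<Rightarrow> real"
  assumes "abs_continuous_on a b f" "abs_continuous_on a b g"
  shows "abs_continuous_on a b (\<lambda>t. c * f t + d * g t)"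
proof (rule abs_continuous_on_dominated[OF assms, of _ "max \<bar>c\<bar> \<bar>d\<bar>"])
  fix x y :: real
  have "\<bar>(c * f y + d * g y) - (c * f x + d * g x)\<bar> = \<bar>c * (f y - f x) + d * (g y - g x)\<bar>"
    by (simp add: algebra_simps)
  also have "\<dots> \<le> \<bar>c\<bar> * \<bar>f y - f x\<bar> + \<bar>d\<bar> * \<bar>g y - g x\<bar>"
    using abs_triangle_ineq[of "c * (f y - f x)" "d * (g y - g x)"] by (simp add: abs_mult)
  also have "\<dots> \<le> max \<bar>c\<bar> \<bar>d\<bar> * \<bar>f y - f x\<bar> + max \<bar>c\<bar> \<bar>d\<bar> * \<bar>g y - g x\<bar>"
    by (intro add_mono mult_right_mono) auto
  finally show "norm (c * f y + d * g y - (c * f x + d * g x))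
      \<le> max \<bar>c\<bar> \<bar>d\<bar> * norm (f y - f x) + max \<bar>c\<bar> \<bar>d\<bar> * norm (g y - g x)"
    by simp
qed

lemma abs_continuous_on_inverse:
  fixes f :: "real \<Rightarrow> real"
  assumes ac: "abs_continuous_on a b f" and c: "c > 0" and f: "\<And>t. t \<in> {a..b} \<Longrightarrow> c \<le> f t"
  shows "abs_continuous_on a b (\<lambda>t. inverse (f t))"
proof (rule abs_continuous_on_dominated[OF ac ac, of _ "inverse (c * c)"])
  fix x y assume xy: "a \<le> x" "x \<le> y" "y \<le> b"
  then have f: "c \<le> f x" "c \<le> f y" using f by auto
  have "\<bar>inverse (f y) - inverse (f x)\<bar> = inverse (f x * f y) * \<bar>f y - f x\<bar>"
  proof -
    have "inverse (f y) - inverse (f x) = inverse (f x * f y) * (f x - f y)"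
      using f c by (simp add: field_simps)
    moreover have "inverse (f x * f y) \<ge> 0" using f c by simp
    ultimately show ?thesis by (simp only: abs_mult abs_of_nonneg abs_minus_commute)
  qed
  also have "\<dots> \<le> inverse (c * c) * \<bar>f y - f x\<bar>"
    using f c by (intro mult_right_mono le_imp_inverse_le mult_mono) auto
  also have "\<dots> \<le> inverse (c * c) * \<bar>f y - f x\<bar> + inverse (c * c) * \<bar>f y - f x\<bar>"
    using c by simp
  finally show "norm (inverse (f y) - inverse (f x))
      \<le> inverse (c * c) * norm (f y - f x) + inverse (c * c) * norm (f y - f x)" by simp
qed

text \<open>Subtracting the line with slope \<open>c\<close> reduces this to monotonicity. The
  hypothesis asks for some derivative at each point, so no derivative function has to be
  chosen.\<close>

lemma abs_continuous_on_AE_deriv_ge: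
  fixes f :: "real \<Rightarrow> real"
  assumes ac: "abs_continuous_on a b f" and ab: "a \<le> b"
    and ae: "AE x in lebesgue. x \<in> {a..b} \<longrightarrow>
      (\<exists>D\<ge>c. (f has_real_derivative D) (at x within {a..b}))"
  shows "c * (b - a) \<le> f b - f a"
proof -
  have "(\<lambda>t. 1 * f t + (- c) * t) a \<le> (\<lambda>t. 1 * f t + (- c) * t) b"
  proof (rule abs_continuous_on_AE_deriv_nonneg[OF
        abs_continuous_on_linear_combination[OF ac abs_continuous_on_ident] ab])
    show "AE x in lebesgue. x \<in> {a..b} \<longrightarrow>
      (\<exists>D\<ge>0. ((\<lambda>t. 1 * f t + (- c) * t) has_real_derivative D) (at x within {a..b}))"
      using ae
    proof (eventually_elim, intro impI)
      fix x assume "x \<in> {a..b} \<longrightarrow> (\<exists>D\<ge>c. (f has_real_derivative D) (at x within {a..b}))" "x \<in> {a..b}"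
      then obtain D where D: "D \<ge> c" "(f has_real_derivative D) (at x within {a..b})" by blast
      show "\<exists>D\<ge>0. ((\<lambda>t. 1 * f t + (- c) * t) has_real_derivative D) (at x within {a..b})"
        by (rule exI[of _ "D - c"]) (use D in \<open>auto intro!: derivative_eq_intros\<close>)
    qed
  qed
  then show ?thesis by (simp add: algebra_simps)
qed

lemma abs_continuous_on_AE_deriv_le:
  fixes f :: "real \<Rightarrow> real"
  assumes ac: "abs_continuous_on a b f" and ab: "a \<le> b"
    and ae: "AE x in lebesgue. x \<in> {a..b} \<longrightarrow>
      (\<exists>D\<le>c. (f has_real_derivative D) (at x within {a..b}))"
  shows "f b - f a \<le> c * (b - a)"
proof -
  have "(- c) * (b - a) \<le> (\<lambda>t. (- 1) * f t + 0 * f t) b - (\<lambda>t. (- 1) * f t + 0 * f t) a"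
  proof (rule abs_continuous_on_AE_deriv_ge[OF abs_continuous_on_linear_combination[OF ac ac] ab])
    show "AE x in lebesgue. x \<in> {a..b} \<longrightarrow>
      (\<exists>D\<ge>- c. ((\<lambda>t. (- 1) * f t + 0 * f t) has_real_derivative D) (at x within {a..b}))"
      using ae
    proof (eventually_elim, intro impI)
      fix x assume "x \<in> {a..b} \<longrightarrow> (\<exists>D\<le>c. (f has_real_derivative D) (at x within {a..b}))" "x \<in> {a..b}"
      then obtain D where D: "D \<le> c" "(f has_real_derivative D) (at x within {a..b})" by blast
      show "\<exists>D\<ge>- c. ((\<lambda>t. (- 1) * f t + 0 * f t) has_real_derivative D) (at x within {a..b})"
        by (rule exI[of _ "- D"]) (use D in \<open>auto intro!: derivative_eq_intros\<close>)
    qed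
  qed
  then show ?thesis by (simp add: algebra_simps)
qed

section \<open>Concavity and convexity on an interval\<close>

text \<open>Since \<open>f'\<close> decreases at rate at least \<kappa>, a value
  \<open>f' t \<le> 0\<close> drives \<open>f\<close> below zero to the right of \<open>t\<close>,
  and a positive value means that \<open>f\<close> was below zero to the left. Hence
  \<open>f' t = 0\<close> need not be established first.\<close>

lemma interior_zero_contradicts_concavity:
  fixes f f' :: "real \<Rightarrow> real"
  assumes ac: "abs_continuous_on a b f" "abs_continuous_on a b f'"
    and t: "a < t" "t < b" and \<kappa>: "\<kappa> > 0"
    and d1: "AE x in lebesgue. x \<in> {a..b} \<longrightarrow> (f has_real_derivative f' x) (at x within {a..b})"
    and d2: "AE x in lebesgue. x \<in> {a..b} \<longrightarrow>
      (\<exists>D\<le>-\<kappa>. (f' has_real_derivative D) (at x within {a..b}))"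
    and nonneg: "\<And>x. x \<in> {a..b} \<Longrightarrow> f x \<ge> 0" and zero: "f t = 0"
  shows False
proof -
  have d1': "AE x in lebesgue. x \<in> {c..d} \<longrightarrow> (f has_real_derivative f' x) (at x within {c..d})"
    if "a \<le> c" "d \<le> b" for c d
    using d1 by eventually_elim (use that in \<open>auto intro: has_field_derivative_subset\<close>)
  have decr: "f' d - f' c \<le> -\<kappa> * (d - c)" if "a \<le> c" "c \<le> d" "d \<le> b" for c d
  proof (rule abs_continuous_on_AE_deriv_le[OF abs_continuous_on_subinterval[OF ac(2)]])
    show "AE x in lebesgue. x \<in> {c..d} \<longrightarrow> (\<exists>D\<le>-\<kappa>. (f' has_real_derivative D) (at x within {c..d}))"
      using d2
    proof (eventually_elim, intro impI)
      fix x assume "x \<in> {a..b} \<longrightarrow> (\<exists>D\<le>-\<kappa>. (f' has_real_derivative D) (at x within {a..b}))"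
        "x \<in> {c..d}"
      moreover have "{c..d} \<subseteq> {a..b}" using that by auto
      ultimately show "\<exists>D\<le>-\<kappa>. (f' has_real_derivative D) (at x within {c..d})"
        by (meson has_field_derivative_subset subsetD)
    qed
  qed (use that in auto)
  show False
  proof (cases "f' t \<le> 0")
    case True
    \<comment> \<open>The bound on \<open>f'\<close> degenerates at \<open>t\<close> itself. Up to
      the midpoint \<open>f\<close> merely does not increase; beyond it the slope is bounded away
      from zero.\<close>
    define s where "s = (t + b) / 2"
    have s: "t < s" "s < b" using t by (auto simp: s_def)
    then have as: "a \<le> s" using t by simp
    have f'_le: "f' x \<le> -\<kappa> * (x - t)" if "t \<le> x" "x \<le> b" for x
      using decr[of t x] that t True by simp
    have "f s - f t \<le> 0 * (s - t)"
    proof (rule abs_continuous_on_AE_deriv_le[OF abs_continuous_on_subinterval[OF ac(1)]])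
      show "AE x in lebesgue. x \<in> {t..s} \<longrightarrow> (\<exists>D\<le>0. (f has_real_derivative D) (at x within {t..s}))"
        using d1'[OF less_imp_le[OF t(1)] less_imp_le[OF s(2)]]
      proof (eventually_elim, intro impI)
        fix x assume "x \<in> {t..s} \<longrightarrow> (f has_real_derivative f' x) (at x within {t..s})" "x \<in> {t..s}"
        moreover from this have "f' x \<le> 0"
          using f'_le[of x] s \<kappa> by (smt (verit) atLeastAtMost_iff mult_minus_left mult_nonneg_nonneg)
        ultimately show "\<exists>D\<le>0. (f has_real_derivative D) (at x within {t..s})" by blast
      qed
    qed (use t s in auto)
    moreover have "f b - f s \<le> (-\<kappa> * (s - t)) * (b - s)"
    proof (rule abs_continuous_on_AE_deriv_le[OF abs_continuous_on_subinterval[OF ac(1)]])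
      show "AE x in lebesgue. x \<in> {s..b} \<longrightarrow>
          (\<exists>D\<le>-\<kappa> * (s - t). (f has_real_derivative D) (at x within {s..b}))"
        using d1'[OF as order_refl]
      proof (eventually_elim, intro impI)
        fix x assume x: "x \<in> {s..b} \<longrightarrow> (f has_real_derivative f' x) (at x within {s..b})" "x \<in> {s..b}"
        have "f' x \<le> -\<kappa> * (x - t)" using f'_le[of x] x s by auto
        moreover have "\<kappa> * (s - t) \<le> \<kappa> * (x - t)" using x \<kappa> by simp
        ultimately have "f' x \<le> -\<kappa> * (s - t)" by simp
        with x show "\<exists>D\<le>-\<kappa> * (s - t). (f has_real_derivative D) (at x within {s..b})" by blast
      qed
    qed (use t s in auto)
    moreover have "(-\<kappa> * (s - t)) * (b - s) < 0"
      using s \<kappa> by (simp add: mult_neg_pos)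
    ultimately have "f b < 0" using zero by simp
    then show False using nonneg[of b] t by auto
  next
    case False
    have "f' t * (t - a) \<le> f t - f a"
    proof (rule abs_continuous_on_AE_deriv_ge[OF abs_continuous_on_subinterval[OF ac(1)]])
      show "AE x in lebesgue. x \<in> {a..t} \<longrightarrow> (\<exists>D\<ge>f' t. (f has_real_derivative D) (at x within {a..t}))"
        using d1'[OF order_refl less_imp_le[OF t(2)]]
      proof (eventually_elim, intro impI)
        fix x assume x: "x \<in> {a..t} \<longrightarrow> (f has_real_derivative f' x) (at x within {a..t})" "x \<in> {a..t}"
        have "\<kappa> * (t - x) \<ge> 0" using x \<kappa> by simp
        then have "f' t \<le> f' x" using decr[of x t] x t by auto
        with x show "\<exists>D\<ge>f' t. (f has_real_derivative D) (at x within {a..t})" by blast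
      qed
    qed (use t in auto)
    moreover have "f' t * (t - a) > 0" using False t by simp
    ultimately have "f a < 0" using zero by simp
    then show False using nonneg[of a] t by auto
  qed
qed

text \<open>If \<open>f\<close> exceeded a chord, the difference \<open>g\<close> would have a
  leftmost maximum point in the interior. There a local support line for \<open>g\<close> with slope
  at most zero gives another maximum further left, and one with positive slope gives a larger value
  to the right.\<close>

lemma convex_on_local_affine_support:
  fixes f :: "real \<Rightarrow> real"
  assumes cont: "continuous_on {a..b} f"
    and supp: "\<And>t. a < t \<Longrightarrow> t < b \<Longrightarrow>
      \<exists>k. \<exists>e>0. \<forall>s\<in>{a..b}. \<bar>s - t\<bar> < e \<longrightarrow> f t + k * (s - t) \<le> f s"
  shows "convex_on {a..b} f"
proof (rule convex_on_linorderI)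
  fix t x y :: real
  assume t: "0 < t" "t < 1" and xy: "x \<in> {a..b}" "y \<in> {a..b}" "x < y"
  define m where "m = (f y - f x) / (y - x)"
  define g where "g = (\<lambda>s. f s - f x - m * (s - x))"
  have gxy: "g x = 0" "g y = 0" using xy by (auto simp: g_def m_def)
  have contg: "continuous_on {x..y} g" unfolding g_def
    using xy by (intro continuous_intros continuous_on_subset[OF cont]) auto
  have "g s \<le> 0" if s: "s \<in> {x..y}" for s
  proof (rule ccontr)
    assume "\<not> g s \<le> 0"
    obtain z where z: "z \<in> {x..y}" "\<And>s. s \<in> {x..y} \<Longrightarrow> g s \<le> g z"
      using continuous_attains_sup[OF _ _ contg] xy by (auto simp: not_le)
    have gz: "g z > 0" using z(2)[OF s] \<open>\<not> g s \<le> 0\<close> by simp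
    define Z where "Z = {x..y} \<inter> g -` {g z}"
    have "closed Z" unfolding Z_def by (rule continuous_closed_preimage[OF contg]) auto
    then have "compact Z" unfolding Z_def by (simp add: bounded_Int compact_eq_bounded_closed)
    moreover have "z \<in> Z" using z by (simp add: Z_def)
    ultimately obtain c where c: "c \<in> Z" "\<And>s. s \<in> Z \<Longrightarrow> c \<le> s"
      using compact_attains_inf[of Z] by blast
    have cxy: "x < c" "c < y"
      using c(1) gz gxy by (auto simp: Z_def less_le)
    have gc: "g c = g z" using c(1) by (simp add: Z_def)
    obtain k e where ke: "e > 0" "\<And>s. s \<in> {a..b} \<Longrightarrow> \<bar>s - c\<bar> < e \<Longrightarrow> f c + k * (s - c) \<le> f s"
    proof -
      have "a < c" "c < b" using cxy xy by auto
      then obtain k e where "e > 0" "\<forall>s\<in>{a..b}. \<bar>s - c\<bar> < e \<longrightarrow> f c + k * (s - c) \<le> f s"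
        using supp by blast
      then show thesis by (intro that) auto
    qed
    have sup: "g c + (k - m) * (s - c) \<le> g s" if "s \<in> {x..y}" "\<bar>s - c\<bar> < e" for s
      using ke(2)[of s] that xy by (auto simp: g_def algebra_simps)
    define h where "h = min (e/2) (min (c - x) (y - c))"
    have h: "h > 0" "h < e" "h \<le> c - x" "h \<le> y - c" using ke(1) cxy by (auto simp: h_def)
    show False
    proof (cases "k \<le> m")
      case True
      then have "(k - m) * (- h) \<ge> 0" using h True by (intro mult_nonpos_nonpos) auto
      then have "g (c - h) \<ge> g z" using sup[of "c - h"] h gc cxy by auto
      then have "c - h \<in> Z" using z(2)[of "c - h"] h cxy by (auto simp: Z_def)
      then show False using c(2)[of "c - h"] h by simp
    next
      case False
      then have "(k - m) * h > 0" using h by simp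
      then have "g (c + h) > g z" using sup[of "c + h"] h gc cxy by auto
      then show False using z(2)[of "c + h"] h cxy by auto
    qed
  qed
  moreover have "(1 - t) *\<^sub>R x + t *\<^sub>R y = x + t * (y - x)" by (simp add: algebra_simps)
  moreover have "x + t * (y - x) \<in> {x..y}"
  proof -
    define h where "h = t * (y - x)"
    have "0 \<le> h" "h \<le> 1 * (y - x)" unfolding h_def using t xy by (auto intro!: mult_right_mono)
    then show ?thesis unfolding h_def[symmetric] by auto
  qed
  ultimately have "g ((1 - t) *\<^sub>R x + t *\<^sub>R y) \<le> 0" by metis
  moreover have "g ((1 - t) *\<^sub>R x + t *\<^sub>R y) = f ((1 - t) *\<^sub>R x + t *\<^sub>R y) - f x - t * (f y - f x)"
    using xy unfolding \<open>(1 - t) *\<^sub>R x + t *\<^sub>R y = x + t * (y - x)\<close> by (simp add: g_def m_def)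
  ultimately show "f ((1 - t) *\<^sub>R x + t *\<^sub>R y) \<le> (1 - t) * f x + t * f y"
    by (simp add: algebra_simps)
qed simp

subsection \<open>The support function of a spherical cap\<close>

lemma vec3_nth [simp]: "vec3 w z $ 1 = w $ 1" "vec3 w z $ 2 = w $ 2" "vec3 w z $ 3 = z"
  unfolding vec3_def vector_3 by (rule refl)+

lemma hor_nth [simp]: "hor p $ 1 = p $ 1" "hor p $ 2 = p $ 2"
  unfolding hor_def vector_2 by (rule refl)+

lemma inner_hor: "p \<bullet> q = hor p \<bullet> hor q + p $ 3 * q $ 3"
  unfolding inner_vec_def sum_2 sum_3 hor_nth inner_real_def by (rule refl)

lemma linear_hor: "linear hor"
  by (rule linearI) (simp_all add: vec_eq_iff forall_2)

lemma norm_hor_sq: "(norm p)\<^sup>2 = (norm (hor p))\<^sup>2 + (p $ 3)\<^sup>2"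
  unfolding power2_norm_eq_inner inner_hor[of p p] unfolding power2_eq_square by (rule refl)

lemma vec3_hor [simp]: "vec3 (hor p) (p $ 3) = p"
  by (simp add: vec_eq_iff forall_3)

lemma hor_vec3 [simp]: "hor (vec3 w z) = w"
  by (simp add: vec_eq_iff forall_2)

text \<open>The uncurried form makes \<open>vec3\<close> a bounded linear map, which yields limits
  and measurability without working in coordinates.\<close>

lemma linear_vec3: "linear (\<lambda>p. vec3 (fst p) (snd p))"
  by (rule linearI; unfold vec_eq_iff forall_3;
      simp only: vec3_nth vector_add_component vector_scaleR_component fst_add snd_add
        fst_scaleR snd_scaleR simp_thms real_scaleR_def)

lemma e_z_simps [simp]: "hor e_z = 0" "e_z $ 3 = 1" "norm e_z = 1" "e_z \<bullet> p = p $ 3" "p \<bullet> e_z = p $ 3"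
proof -
  show 1: "hor e_z = 0" "e_z $ 3 = 1"
    by (simp_all add: e_z_def hor_def vec_eq_iff forall_2)
  have "(norm e_z)\<^sup>2 = 1" by (subst norm_hor_sq) (simp add: 1)
  then show "norm e_z = 1" by (intro power2_eq_imp_eq[of _ 1]) simp_all
  show "e_z \<bullet> p = p $ 3" "p \<bullet> e_z = p $ 3" by (simp_all add: inner_hor 1)
qed

text \<open>The support function of the cap of all unit vectors \<open>w\<close> with \<open>cos \<theta> \<le> w $ 3\<close>.\<close>

definition cap_support :: "real \<Rightarrow> real^3 \<Rightarrow> real"
  where "cap_support \<theta> p =
    (if norm p * cos \<theta> \<le> p $ 3 then norm p else sin \<theta> * norm (hor p) + cos \<theta> * p $ 3)"

text \<open>For \<open>p\<close> inside the cone around the vertical this is Cauchy-Schwarz.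
  Otherwise Cauchy-Schwarz in the horizontal plane leaves a planar problem: among unit vectors with
  height at least \<open>cos \<theta>\<close>, the one on the rim is the best.\<close>

lemma inner_le_cap_support:
  assumes \<theta>: "0 \<le> \<theta>" "\<theta> < pi / 2" and w: "norm w = 1" "cos \<theta> \<le> w $ 3"
  shows "p \<bullet> w \<le> cap_support \<theta> p"
proof (cases "norm p * cos \<theta> \<le> p $ 3")
  case True
  then show ?thesis using norm_cauchy_schwarz[of p w] w by (simp add: cap_support_def)
next
  case False
  define S C a b x z where "S = sin \<theta>" "C = cos \<theta>" "a = w $ 3" "b = norm (hor w)" "x = norm (hor p)" "z = p $ 3"
  note defs = this
  have SC: "S \<ge> 0" "C > 0" "S\<^sup>2 + C\<^sup>2 = 1"
    using \<theta> unfolding defs by (auto intro!: sin_ge_zero cos_gt_zero_pi)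
  have ab: "a\<^sup>2 + b\<^sup>2 = 1" "a \<ge> C" "b \<ge> 0" using w norm_hor_sq[of w] by (auto simp: defs)
  have x: "x \<ge> 0" by (simp add: defs)
  have bS: "b \<le> S"
  proof (rule power2_le_imp_le)
    have "C\<^sup>2 \<le> a\<^sup>2" using ab SC by (simp add: power_mono)
    then show "b\<^sup>2 \<le> S\<^sup>2" using ab(1) SC(3) by linarith
  qed (fact SC)
  have "z * (a - C) \<le> x * (S - b)"
  proof (cases "z \<le> 0")
    case True
    then have "z * (a - C) \<le> 0" "0 \<le> x * (S - b)"
      using ab x bS by (auto simp: mult_nonpos_nonneg)
    then show ?thesis by linarith
  next
    case z: False
    have "z\<^sup>2 < (norm p * C)\<^sup>2"
      using False z by (intro power_strict_mono) (auto simp: defs)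
    also have "\<dots> = (x\<^sup>2 + z\<^sup>2) * C\<^sup>2" using norm_hor_sq[of p] by (simp add: power_mult_distrib defs)
    finally have "z\<^sup>2 * (S\<^sup>2 + C\<^sup>2) < (x\<^sup>2 + z\<^sup>2) * C\<^sup>2"
      unfolding SC(3) mult_1_right .
    then have "(z * S)\<^sup>2 < (x * C)\<^sup>2"
      unfolding power_mult_distrib distrib_left distrib_right by linarith
    then have zS: "z * S < x * C" by (rule power2_less_imp_less) (simp add: x SC less_imp_le)
    \<comment> \<open>The squared distance of two points of the unit circle is expanded; its
      nonnegativity is the tangent inequality at the rim point with height \<open>C\<close> and
      radius \<open>S\<close>.\<close>
    have "(a - C)\<^sup>2 + (b - S)\<^sup>2 = 2 * (S * (S - b)) - 2 * (C * (a - C))"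
      using ab(1) SC(3) unfolding power2_eq_square by algebra
    then have "C * (a - C) \<le> S * (S - b)"
      using zero_le_power2[of "a - C"] zero_le_power2[of "b - S"] by linarith
    then have "z * (C * (a - C)) \<le> z * (S * (S - b))" using z by (intro mult_left_mono) auto
    also have "\<dots> = (z * S) * (S - b)" by simp
    also have "\<dots> \<le> (x * C) * (S - b)" using zS bS by (intro mult_right_mono) auto
    finally have "C * (z * (a - C)) \<le> C * (x * (S - b))" by (simp add: algebra_simps)
    then show ?thesis using SC by simp
  qed
  moreover have "hor p \<bullet> hor w \<le> x * b" unfolding defs by (rule norm_cauchy_schwarz)
  ultimately have "p \<bullet> w \<le> S * x + C * z" unfolding inner_hor[of p w] defs(3,6)[symmetric]
    by (simp add: algebra_simps)
  then show ?thesis using False by (simp add: cap_support_def defs)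
qed

text \<open>The left side is the product of \<open>p\<close> with the centre of the rim circle of
  the cap. This centre lies in the convex hull of the cap and replaces a maximizing direction where
  the latter is not unique.\<close>

lemma vertical_le_cap_support:
  assumes \<theta>: "0 \<le> \<theta>" "\<theta> < pi / 2"
  shows "cos \<theta> * p $ 3 \<le> cap_support \<theta> p"
proof -
  have C: "0 \<le> cos \<theta>" "cos \<theta> \<le> 1" using cos_gt_zero_pi[of \<theta>] \<theta> by auto
  have "cos \<theta> * p $ 3 \<le> cos \<theta> * \<bar>p $ 3\<bar>" using C by (intro mult_left_mono) auto
  also have "\<dots> \<le> norm p"
    using C component_le_norm_cart[of p 3] mult_left_le_one_le[of "\<bar>p $ 3\<bar>" "cos \<theta>"] by simp
  finally show ?thesis using \<theta> sin_ge_zero[of \<theta>] by (auto simp: cap_support_def)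
qed

section \<open>Maximizing directions\<close>

text \<open>The pointwise content of \<open>thrust_direction\<close> with the control left out. At
  \<open>p = 0\<close> only the unit norm remains, so \<open>w\<close> may then lie outside the
  cap.\<close>

definition cap_direction :: "real \<Rightarrow> real^3 \<Rightarrow> real^3 \<Rightarrow> bool"
  where "cap_direction \<theta> p w \<longleftrightarrow> norm w = 1 \<and>
       (p $ 3 \<ge> norm p * cos \<theta> \<and> p \<noteq> 0 \<longrightarrow> w = p /\<^sub>R norm p) \<and>
       (p $ 3 < norm p * cos \<theta> \<and> hor p \<noteq> 0 \<longrightarrow>
          w = vec3 (sin \<theta> *\<^sub>R (hor p /\<^sub>R norm (hor p))) (cos \<theta>)) \<and>
       (p $ 3 < norm p * cos \<theta> \<and> hor p = 0 \<longrightarrow>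
          (\<exists>\<delta>\<in>sphere 0 1. w = vec3 (sin \<theta> *\<^sub>R \<delta>) (cos \<theta>)))"

lemma cap_direction_inner:
  assumes "cap_direction \<theta> p w"
  shows "p \<bullet> w = cap_support \<theta> p"
proof (cases "p = 0")
  case True
  then show ?thesis by (simp add: cap_support_def)
next
  case False
  consider "p $ 3 \<ge> norm p * cos \<theta>" | "p $ 3 < norm p * cos \<theta>" "hor p \<noteq> 0"
    | "p $ 3 < norm p * cos \<theta>" "hor p = 0" by linarith
  then show ?thesis
  proof cases
    case 1
    then have "w = p /\<^sub>R norm p" using False assms by (auto simp: cap_direction_def)
    then show ?thesis using 1 False
      by (simp add: cap_support_def power2_norm_eq_inner[symmetric] power2_eq_square)
  next
    case 2
    then have "w = vec3 (sin \<theta> *\<^sub>R (hor p /\<^sub>R norm (hor p))) (cos \<theta>)"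
      using assms by (auto simp: cap_direction_def)
    then show ?thesis using 2
      by (simp add: cap_support_def inner_hor[of p] power2_norm_eq_inner[symmetric] power2_eq_square)
  next
    case 3
    then obtain \<delta> where "w = vec3 (sin \<theta> *\<^sub>R \<delta>) (cos \<theta>)"
      using assms by (auto simp: cap_direction_def)
    then show ?thesis using 3 by (simp add: cap_support_def inner_hor[of p])
  qed
qed

lemma cap_direction_vertical:
  assumes "cap_direction \<theta> p w" "p \<noteq> 0"
  shows "cos \<theta> \<le> w $ 3"
proof (cases "p $ 3 \<ge> norm p * cos \<theta>")
  case True
  then show ?thesis using assms by (auto simp: cap_direction_def field_simps)
next
  case False
  then show ?thesis using assms by (cases "hor p = 0") (auto simp: cap_direction_def)
qed

lemma cap_support_attained:
  assumes \<theta>: "0 \<le> \<theta>" "\<theta> < pi / 2"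
  obtains w where "norm w = 1" "cos \<theta> \<le> w $ 3" "p \<bullet> w = cap_support \<theta> p"
proof (cases "p = 0")
  case True
  \<comment> \<open>A \<open>cap_direction\<close> of zero need not lie in the cap, so a member of
    the cap is named explicitly.\<close>
  then show ?thesis by (intro that[of e_z]) (auto simp: cap_support_def)
next
  case False
  \<comment> \<open>This serves a vertical \<open>p\<close> pointing downwards, for which every
    point of the rim is a maximizer.\<close>
  obtain \<delta> :: "real^2" where \<delta>: "norm \<delta> = 1" using vector_choose_size[of 1] by auto
  have unit: "norm (vec3 (sin \<theta> *\<^sub>R v) (cos \<theta>)) = 1" if "norm v = 1" for v :: "real^2"
  proof -
    have "(norm (vec3 (sin \<theta> *\<^sub>R v) (cos \<theta>)))\<^sup>2 = 1"
      by (subst norm_hor_sq) (simp add: that power_mult_distrib)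
    then show ?thesis by (intro power2_eq_imp_eq[of _ 1]) simp_all
  qed
  consider "p $ 3 \<ge> norm p * cos \<theta>" | "p $ 3 < norm p * cos \<theta>" "hor p \<noteq> 0"
    | "p $ 3 < norm p * cos \<theta>" "hor p = 0" by linarith
  then have "\<exists>w. cap_direction \<theta> p w"
  proof cases
    case 1
    then show ?thesis using False by (intro exI[of _ "p /\<^sub>R norm p"]) (auto simp: cap_direction_def)
  next
    case 2
    then show ?thesis using unit[of "hor p /\<^sub>R norm (hor p)"]
      by (intro exI[of _ "vec3 (sin \<theta> *\<^sub>R (hor p /\<^sub>R norm (hor p))) (cos \<theta>)"])
         (auto simp: cap_direction_def)
  next
    case 3
    then show ?thesis using unit[OF \<delta>] \<delta>
      by (intro exI[of _ "vec3 (sin \<theta> *\<^sub>R \<delta>) (cos \<theta>)"]) (auto simp: cap_direction_def)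
  qed
  then obtain w where w: "cap_direction \<theta> p w" by blast
  then show ?thesis
    using that[of w] cap_direction_inner[OF w] cap_direction_vertical[OF w False]
    by (auto simp: cap_direction_def)
qed

text \<open>A maximum of linear functionals of norm one is Lipschitz with constant one, so the case
  distinction in the definition never has to be examined.\<close>

lemma continuous_on_cap_support:
  assumes \<theta>: "0 \<le> \<theta>" "\<theta> < pi / 2" and f: "continuous_on S f"
  shows "continuous_on S (\<lambda>x. cap_support \<theta> (f x))"
proof -
  have le: "cap_support \<theta> p - cap_support \<theta> q \<le> norm (p - q)" for p q
  proof -
    obtain w where w: "norm w = 1" "cos \<theta> \<le> w $ 3" "p \<bullet> w = cap_support \<theta> p"
      using cap_support_attained[OF \<theta>] .
    have "cap_support \<theta> p - cap_support \<theta> q \<le> (p - q) \<bullet> w"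
      using inner_le_cap_support[OF \<theta> w(1,2), of q] w(3) by (simp add: inner_diff_left)
    also have "\<dots> \<le> norm (p - q)" using norm_cauchy_schwarz[of "p - q" w] w by simp
    finally show ?thesis .
  qed
  have "continuous_on UNIV (cap_support \<theta>)"
    unfolding continuous_on_iff dist_norm
  proof (intro ballI allI impI)
    fix p and e :: real assume "e > 0"
    moreover have "norm (cap_support \<theta> q - cap_support \<theta> p) \<le> norm (q - p)" for q
      using le[of p q] le[of q p] by (auto simp: norm_minus_commute)
    ultimately show "\<exists>d>0. \<forall>x'\<in>UNIV. norm (x' - p) < d \<longrightarrow> norm (cap_support \<theta> x' - cap_support \<theta> p) < e"
      by (intro exI[of _ e]) (auto intro: order_le_less_trans)
  qed
  from continuous_on_compose2[OF this f] show ?thesis by simp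
qed

text \<open>On the vertical axis the assumption puts \<open>p t\<close> strictly inside the cone,
  where the direction is the normalization of \<open>p\<close>. Off the axis both regimes obey one
  continuous formula.\<close>

lemma cap_direction_tendsto:
  assumes \<theta>: "0 \<le> \<theta>" "\<theta> < pi / 2"
    and p: "(p \<longlongrightarrow> p t) (at t within T)" and d: "\<And>s. s \<in> T \<Longrightarrow> cap_direction \<theta> (p s) (d s)" and t: "t \<in> T"
    and reg: "hor (p t) \<noteq> 0 \<or> p t $ 3 > norm (p t) * cos \<theta>"
  shows "(d \<longlongrightarrow> d t) (at t within T)"
proof (cases "hor (p t) = 0")
  case True
  then have reg: "p t $ 3 > norm (p t) * cos \<theta>" using reg by simp
  then have pt: "p t \<noteq> 0" by auto
  have "\<forall>\<^sub>F s in at t within T. p s $ 3 - norm (p s) * cos \<theta> > 0"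
    by (rule order_tendstoD(1)[of _ "p t $ 3 - norm (p t) * cos \<theta>"])
       (use reg p in \<open>auto intro!: tendsto_intros\<close>)
  then have "\<forall>\<^sub>F s in at t within T. d s = p s /\<^sub>R norm (p s)"
    unfolding eventually_at_filter
  proof eventually_elim
    case (elim s)
    show ?case
    proof (intro impI)
      assume "s \<noteq> t" "s \<in> T"
      then have "p s $ 3 > norm (p s) * cos \<theta>" using elim by simp
      moreover from this have "p s \<noteq> 0" by auto
      ultimately show "d s = p s /\<^sub>R norm (p s)" using d[OF \<open>s \<in> T\<close>] by (auto simp: cap_direction_def)
    qed
  qed
  moreover have "d t = p t /\<^sub>R norm (p t)" using d[OF t] reg pt by (auto simp: cap_direction_def)
  moreover have "((\<lambda>s. p s /\<^sub>R norm (p s)) \<longlongrightarrow> p t /\<^sub>R norm (p t)) (at t within T)"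
    using p pt by (auto intro!: tendsto_intros)
  ultimately show ?thesis by (simp add: tendsto_cong)
next
  case False
  \<comment> \<open>\<open>c\<close> is the height of the direction, and \<open>D\<close> restores
    the horizontal part from the unit norm. The maximum merges the two regimes, so crossing the
    boundary of the cone needs no separate argument.\<close>
  define c where "c = (\<lambda>p :: real^3. max (cos \<theta>) (p $ 3 / norm p))"
  define D where "D = (\<lambda>p. vec3 (sqrt (1 - (c p)\<^sup>2) *\<^sub>R (hor p /\<^sub>R norm (hor p))) (c p))"
  have C: "cos \<theta> > 0" using \<theta> by (auto intro: cos_gt_zero_pi)
  have S: "sqrt (1 - (cos \<theta>)\<^sup>2) = sin \<theta>"
  proof -
    have "sin \<theta> \<ge> 0" using \<theta> by (intro sin_ge_zero) auto
    then show ?thesis by (simp flip: sin_squared_eq)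
  qed
  have D: "w = D q" if w: "cap_direction \<theta> q w" and q: "hor q \<noteq> 0" for q w
  proof (cases "q $ 3 \<ge> norm q * cos \<theta>")
    case True
    have q0: "norm q > 0" using q linear_0[OF linear_hor] by auto
    then have c: "c q = q $ 3 / norm q" using True by (auto simp: c_def max_def field_simps)
    have "1 - (c q)\<^sup>2 = (norm (hor q) / norm q)\<^sup>2"
    proof -
      have "(norm (hor q))\<^sup>2 = (norm q)\<^sup>2 - (q $ 3)\<^sup>2" using norm_hor_sq[of q] by simp
      then show ?thesis using q0 by (simp add: c power_divide diff_divide_distrib)
    qed
    then have "sqrt (1 - (c q)\<^sup>2) = norm (hor q) / norm q" by simp
    then have "D q = vec3 (hor q /\<^sub>R norm q) (q $ 3 / norm q)"
    proof -
      have "norm (hor q) / norm q * inverse (norm (hor q)) = inverse (norm q)"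
        using q by (simp add: divide_inverse)
      then show ?thesis
        unfolding D_def c \<open>sqrt (1 - (c q)\<^sup>2) = norm (hor q) / norm q\<close>[unfolded c] scaleR_scaleR by simp
    qed
    also have "\<dots> = vec3 (hor (q /\<^sub>R norm q)) ((q /\<^sub>R norm q) $ 3)"
      by (simp add: linear_scale[OF linear_hor] divide_inverse mult.commute)
    also have "\<dots> = w" unfolding vec3_hor using w True q0 by (auto simp: cap_direction_def)
    finally show ?thesis by simp
  next
    case False
    have q0: "norm q > 0" using q linear_0[OF linear_hor] by auto
    then have "c q = cos \<theta>" using False by (auto simp: c_def max_def field_simps)
    then show ?thesis using w False q S by (simp add: cap_direction_def D_def)
  qed
  have "((\<lambda>s. hor (p s)) \<longlongrightarrow> hor (p t)) (at t within T)"
    using linear_hor linear_conv_bounded_linear bounded_linear.tendsto p by blast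
  note hp = this
  have pt: "p t \<noteq> 0" using False linear_0[OF linear_hor] by auto
  have "\<forall>\<^sub>F s in at t within T. hor (p s) \<noteq> 0" by (rule tendsto_imp_eventually_ne[OF hp False])
  then have "\<forall>\<^sub>F s in at t within T. d s = D (p s)"
    unfolding eventually_at_filter by eventually_elim (use D d in auto)
  moreover have "d t = D (p t)" using D d t False by auto
  moreover have "((\<lambda>s. D (p s)) \<longlongrightarrow> D (p t)) (at t within T)"
  proof -
    have c: "((\<lambda>s. c (p s)) \<longlongrightarrow> c (p t)) (at t within T)" unfolding c_def
      using p pt by (auto intro!: tendsto_intros)
    have "((\<lambda>s. (sqrt (1 - (c (p s))\<^sup>2) *\<^sub>R (hor (p s) /\<^sub>R norm (hor (p s))), c (p s)))
        \<longlongrightarrow> (sqrt (1 - (c (p t))\<^sup>2) *\<^sub>R (hor (p t) /\<^sub>R norm (hor (p t))), c (p t))) (at t within T)"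
      using c hp False by (auto intro!: tendsto_intros)
    from bounded_linear.tendsto[OF linear_vec3[unfolded linear_conv_bounded_linear] this]
    show ?thesis by (simp add: D_def)
  qed
  ultimately show ?thesis by (simp add: tendsto_cong)
qed

subsection \<open>Extremals of the landing problem\<close>

lemma gravity_simps [simp]: "hor (gravity L) = 0" "gravity L $ 3 = lp_g0 L"
  by (simp_all add: gravity_def hor_def vec_eq_iff forall_2)

text \<open>A crude uniform bound, also valid on the vertical axis, that makes the normals
  integrable against the finite measure \<mu>.\<close>

lemma norm_glide_normal_le: "norm (glide_normal L x) \<le> \<bar>tan (lp_gamma L)\<bar> + 1"
proof (rule power2_le_imp_le)
  define \<tau> where "\<tau> = \<bar>tan (lp_gamma L)\<bar>"
  have "norm (hor (glide_normal L x)) \<le> \<tau>"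
  proof -
    have "norm (hor (glide_normal L x)) = \<tau> * norm (hor x /\<^sub>R norm (hor x))"
      unfolding glide_normal_def hor_vec3 norm_scaleR \<tau>_def by simp
    moreover have "norm (hor x /\<^sub>R norm (hor x)) \<le> 1" by (cases "hor x = 0") simp_all
    ultimately show ?thesis by (simp add: \<tau>_def mult_left_le)
  qed
  then have "(norm (hor (glide_normal L x)))\<^sup>2 \<le> \<tau>\<^sup>2" by (intro power_mono) auto
  moreover have "(norm (glide_normal L x))\<^sup>2 = (norm (hor (glide_normal L x)))\<^sup>2 + 1"
    by (subst norm_hor_sq) (simp add: glide_normal_def)
  moreover have "(\<tau> + 1)\<^sup>2 = \<tau>\<^sup>2 + 2 * \<tau> + 1" "\<tau> \<ge> 0"
    by (simp_all add: power2_sum \<tau>_def)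
  ultimately show "(norm (glide_normal L x))\<^sup>2 \<le> (\<bar>tan (lp_gamma L)\<bar> + 1)\<^sup>2"
    unfolding \<tau>_def[symmetric] by linarith
qed simp

text \<open>For \<gamma> > 0 the normal is discontinuous on the vertical axis, so measurability is
  assembled from the operations in its definition.\<close>

lemma borel_measurable_glide_normal: "glide_normal L \<in> borel_measurable borel"
proof -
  have [measurable]: "hor \<in> borel_measurable borel"
    using linear_hor by (intro borel_measurable_continuous_onI linear_continuous_on)
      (simp add: linear_conv_bounded_linear)
  have 1: "(\<lambda>x. (- tan (lp_gamma L) *\<^sub>R (hor x /\<^sub>R norm (hor x)), 1 :: real)) \<in> borel_measurable borel"
    by measurable
  have 2: "(\<lambda>p. vec3 (fst p) (snd p)) \<in> borel_measurable borel"
    using linear_vec3 by (intro borel_measurable_continuous_onI linear_continuous_on)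
      (simp add: linear_conv_bounded_linear)
  show ?thesis
    using measurable_compose[OF 1 2] by (simp add: glide_normal_def[abs_def])
qed

section \<open>Elementary bounds along an extremal\<close>

locale landing_extremal =
  fixes L :: landing and tf p0 :: real
    and r v u pr pv d :: "real \<Rightarrow> real^3" and m pm :: "real \<Rightarrow> real"
    and \<mu> :: "real measure"
  assumes data: "landing_data L"
    and adm: "admissible L tf r v m u"
    and pmp: "pmp_multipliers L tf r v m u p0 pr pv pm \<mu>"
    and dir: "thrust_direction L tf u pv d"
begin

text \<open>This is \<open>pv t \<bullet> d t\<close> expressed without \<open>d\<close>, hence
  continuous even where \<open>d\<close> jumps.\<close>

definition F :: "real \<Rightarrow> real"
  where "F t = cap_support (lp_theta L) (pv t)"

lemma \<theta>: "0 \<le> lp_theta L" "lp_theta L < pi / 2"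
  using data by (auto simp: landing_data_def)

lemma cos_\<theta>: "0 < cos (lp_theta L)"
  using \<theta> by (auto intro: cos_gt_zero_pi)

lemma tan_\<gamma>: "0 \<le> tan (lp_gamma L)"
  using data by (cases "lp_gamma L = 0") (auto simp: landing_data_def intro!: less_imp_le[OF tan_gt_zero])

lemma cap_direction_d: "t \<in> {0..tf} \<Longrightarrow> cap_direction (lp_theta L) (pv t) (d t)"
  using dir by (simp add: thrust_direction_def cap_direction_def)

lemma u_eq: "t \<in> {0..tf} \<Longrightarrow> u t = norm (u t) *\<^sub>R d t"
  using dir by (cases "u t = 0") (auto simp: thrust_direction_def)

lemma inner_u: "t \<in> {0..tf} \<Longrightarrow> pv t \<bullet> u t = norm (u t) * F t"
  using cap_direction_inner[OF cap_direction_d] u_eq unfolding F_def by (metis inner_scaleR_right)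

lemma u_in: "t \<in> {0..tf} \<Longrightarrow> u t \<in> control_set L"
  using adm by (auto simp: admissible_def)

lemma norm_u_le: "t \<in> {0..tf} \<Longrightarrow> norm (u t) \<le> 1"
  using u_in[of t] data by (auto simp: landing_data_def control_set_def)

lemma ac: "abs_continuous_on 0 tf r" "abs_continuous_on 0 tf v" "abs_continuous_on 0 tf m"
    "abs_continuous_on 0 tf pr" "abs_continuous_on 0 tf pv" "abs_continuous_on 0 tf pm"
  using adm pmp by (auto simp: admissible_def pmp_multipliers_def)

text \<open>The strict mass bound stops short of the final time; continuity carries its weak form
  over. If \<open>tf = 0\<close> the strict bound is vacuous and the initial mass is used
  instead.\<close>

lemma mass_ge:
  assumes t: "t \<in> {0..tf}"
  shows "lp_me L \<le> m t"
proof (cases "t < tf")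
  case True
  then show ?thesis using t adm by (auto simp: admissible_def intro: less_imp_le)
next
  case False
  then have t: "t = tf" using t by auto
  show ?thesis
  proof (cases "tf = 0")
    case True
    then show ?thesis using t data adm by (auto simp: admissible_def landing_data_def)
  next
    case False
    show ?thesis
    proof (rule ccontr)
      assume "\<not> lp_me L \<le> m t"
      then have "lp_me L - m tf > 0" using t by simp
      moreover have tf: "tf \<in> {0..tf}" "tf > 0" using adm False by (auto simp: admissible_def)
      ultimately obtain e where e: "e > 0"
        "\<And>s. s \<in> {0..tf} \<Longrightarrow> dist s tf < e \<Longrightarrow> dist (m s) (m tf) < lp_me L - m tf"
        using abs_continuous_on_imp_continuous_on[OF ac(3)] unfolding continuous_on_iff by meson
      define s where "s = max 0 (tf - e / 2)"
      have "s \<in> {0..<tf}" "dist s tf < e" using e(1) tf by (auto simp: s_def dist_real_def)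
      moreover from this have "m s > lp_me L" using adm by (auto simp: admissible_def)
      ultimately show False using e(2)[of s] by (auto simp: dist_real_def)
    qed
  qed
qed

lemma mass_pos: "t \<in> {0..tf} \<Longrightarrow> m t > 0"
  using mass_ge[of t] data by (auto simp: landing_data_def)

lemma space_\<mu>: "space \<mu> = {0..tf}"
  using pmp sets_eq_imp_space_eq[of \<mu> "restrict_space borel {0..tf}"]
  by (auto simp: pmp_multipliers_def space_restrict_space)

lemma sets_\<mu>: "A \<in> sets \<mu> \<longleftrightarrow> A \<in> sets borel \<and> A \<subseteq> {0..tf}"
  using pmp by (auto simp: pmp_multipliers_def sets_restrict_space_iff)

section \<open>The adjoint vector and the contact measure\<close>

lemma integrable_normal:
  assumes "A \<in> sets \<mu>"
  shows "integrable \<mu> (\<lambda>s. indicator A s *\<^sub>R glide_normal L (r s))"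
proof -
  interpret finite_measure \<mu> using pmp by (simp add: pmp_multipliers_def)
  have "r \<in> borel_measurable (restrict_space borel {0..tf})"
    by (intro borel_measurable_continuous_on_restrict abs_continuous_on_imp_continuous_on ac)
  then have "r \<in> borel_measurable \<mu>"
    using pmp measurable_cong_sets[of \<mu> "restrict_space borel {0..tf}" borel borel]
    by (auto simp: pmp_multipliers_def)
  then have "(\<lambda>s. glide_normal L (r s)) \<in> borel_measurable \<mu>"
    by (rule measurable_compose) (rule borel_measurable_glide_normal)
  then show ?thesis
    using assms norm_glide_normal_le
    by (intro integrable_const_bound[where B = "\<bar>tan (lp_gamma L)\<bar> + 1"] borel_measurable_scaleR
        borel_measurable_indicator) (auto simp: indicator_def intro: order_trans[OF abs_ge_zero])
qed

lemma pr_const: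
  assumes "0 \<le> a" "a \<le> b" "b \<le> tf"
  shows "pr a \<bullet> w = pr b \<bullet> w"
proof -
  have der: "AE x in lebesgue. x \<in> {a..b} \<longrightarrow> ((\<lambda>t. pr t \<bullet> w) has_real_derivative 0) (at x within {a..b})"
  proof -
    have "AE x in lebesgue. x \<in> {0..tf} \<longrightarrow> (pr has_vector_derivative 0) (at x within {0..tf})"
      using pmp unfolding pmp_multipliers_def by (auto elim: AE_mp)
    then show ?thesis
    proof (eventually_elim, intro impI)
      fix x assume "x \<in> {0..tf} \<longrightarrow> (pr has_vector_derivative 0) (at x within {0..tf})" "x \<in> {a..b}"
      then have "(pr has_vector_derivative 0) (at x within {a..b})"
        using assms by (auto intro: has_vector_derivative_within_subset)
      from bounded_linear.has_vector_derivative[OF bounded_linear_inner_left this, of w]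
      show "((\<lambda>t. pr t \<bullet> w) has_real_derivative 0) (at x within {a..b})"
        by (simp add: has_real_derivative_iff_has_vector_derivative)
    qed
  qed
  note ac' = abs_continuous_on_subinterval[OF abs_continuous_on_inner_left[OF ac(4)] assms(1,3)]
  have "pr b \<bullet> w - pr a \<bullet> w \<le> 0 * (b - a)"
    by (rule abs_continuous_on_AE_deriv_le[OF ac' assms(2)]) (use der in \<open>eventually_elim, blast\<close>)
  moreover have "0 * (b - a) \<le> pr b \<bullet> w - pr a \<bullet> w"
    by (rule abs_continuous_on_AE_deriv_ge[OF ac' assms(2)]) (use der in \<open>eventually_elim, blast\<close>)
  ultimately show ?thesis by simp
qed

text \<open>Because \<open>pr\<close> is constant, the decrease from \<open>a\<close> to
  \<open>b\<close> is the integral of the normals over \<open>{a..<b}\<close>. The half-open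
  interval matches \<open>adjoint_q\<close>: an atom at \<open>b\<close> is not yet counted.\<close>

lemma adjoint_q_antimono:
  assumes ab: "0 \<le> a" "a \<le> b" "b \<le> tf"
    and pos: "AE s in \<mu>. s \<in> {a..<b} \<longrightarrow> 0 \<le> glide_normal L (r s) \<bullet> w"
  shows "adjoint_q L r pr \<mu> b \<bullet> w \<le> adjoint_q L r pr \<mu> a \<bullet> w"
proof -
  have meas: "{0..<a} \<in> sets \<mu>" "{0..<b} \<in> sets \<mu>" using ab by (auto simp: sets_\<mu>)
  have int: "integrable \<mu> (\<lambda>s. (indicator A s *\<^sub>R glide_normal L (r s)) \<bullet> w)" if "A \<in> sets \<mu>" for A
    by (rule integrable_inner_left) (rule integrable_normal[OF that])
  have eq: "(LINT s:{0..<c}|\<mu>. glide_normal L (r s)) \<bullet> w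
      = (\<integral>s. (indicator {0..<c} s *\<^sub>R glide_normal L (r s)) \<bullet> w \<partial>\<mu>)"
    if "{0..<c} \<in> sets \<mu>" for c
    unfolding set_lebesgue_integral_def
    by (rule integral_inner_left[symmetric]) (rule integrable_normal[OF that])
  have "(\<integral>s. (indicator {0..<a} s *\<^sub>R glide_normal L (r s)) \<bullet> w \<partial>\<mu>)
      \<le> (\<integral>s. (indicator {0..<b} s *\<^sub>R glide_normal L (r s)) \<bullet> w \<partial>\<mu>)"
  proof (rule integral_mono_AE)
    show "AE s in \<mu>. (indicator {0..<a} s *\<^sub>R glide_normal L (r s)) \<bullet> w
        \<le> (indicator {0..<b} s *\<^sub>R glide_normal L (r s)) \<bullet> w"
      using pos by eventually_elim (use ab in \<open>auto simp: indicator_def\<close>)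
  qed (intro int meas)+
  then show ?thesis
    using pr_const[OF ab, of w] eq meas by (simp add: adjoint_q_def inner_diff_left)
qed

lemma noncontact_null:
  assumes t: "t \<in> {0..tf}" and "glide_slope L (r t) \<noteq> 0"
  obtains e where "e > 0" "AE s in \<mu>. \<not> \<bar>s - t\<bar> < e"
proof -
  have "t \<notin> measure_support \<mu>" using assms pmp by (auto simp: pmp_multipliers_def)
  then obtain U where U: "open U" "t \<in> U" "emeasure \<mu> (U \<inter> space \<mu>) = 0"
    using t by (auto simp: measure_support_def space_\<mu>)
  then obtain e where e: "e > 0" "ball t e \<subseteq> U" by (meson open_contains_ball)
  have "U \<inter> space \<mu> \<in> null_sets \<mu>" using U by (auto simp: null_sets_def sets_\<mu> space_\<mu>)
  moreover have "{s \<in> space \<mu>. \<not> (\<not> \<bar>s - t\<bar> < e)} \<subseteq> U \<inter> space \<mu>"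
    using e by (auto simp: dist_real_def subset_iff abs_minus_commute)
  ultimately have "AE s in \<mu>. \<not> \<bar>s - t\<bar> < e" by (rule AE_I')
  with e(1) show ?thesis by (rule that)
qed

text \<open>Near \<open>t\<close> the function \<open>pv s \<bullet> w\<close> has a nondecreasing
  derivative almost everywhere, so it stays above the line through its value at \<open>t\<close>
  with slope \<open>- (q_r \<bullet> w)\<close> taken at \<open>t\<close>. It lies below
  \<open>F\<close> and equals \<open>F\<close> at \<open>t\<close>. The derivative need not exist at
  \<open>t\<close> itself; monotonicity of the adjoint suffices.\<close>

lemma local_affine_support:
  assumes t: "t \<in> {0..tf}" and w: "\<And>p. p \<bullet> w \<le> cap_support (lp_theta L) p" "pv t \<bullet> w = F t"
    and pos: "AE s in \<mu>. \<bar>s - t\<bar> < e \<longrightarrow> 0 \<le> glide_normal L (r s) \<bullet> w"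
    and s: "s \<in> {0..tf}" "\<bar>s - t\<bar> < e"
  shows "F t + (- (adjoint_q L r pr \<mu> t \<bullet> w)) * (s - t) \<le> F s"
proof -
  define k where "k = - (adjoint_q L r pr \<mu> t \<bullet> w)"
  have der: "AE x in lebesgue. x \<in> {a..b} \<longrightarrow>
      ((\<lambda>t. pv t \<bullet> w) has_real_derivative (- (adjoint_q L r pr \<mu> x \<bullet> w))) (at x within {a..b})"
    if "0 \<le> a" "b \<le> tf" for a b
  proof -
    have "AE x in lebesgue. x \<in> {0..tf} \<longrightarrow>
        (pv has_vector_derivative (- adjoint_q L r pr \<mu> x)) (at x within {0..tf})"
      using pmp unfolding pmp_multipliers_def by (auto elim: AE_mp)
    then show ?thesis
    proof (eventually_elim, intro impI)
      fix x assume "x \<in> {0..tf} \<longrightarrow>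
        (pv has_vector_derivative (- adjoint_q L r pr \<mu> x)) (at x within {0..tf})" "x \<in> {a..b}"
      then have "(pv has_vector_derivative (- adjoint_q L r pr \<mu> x)) (at x within {a..b})"
        using that by (auto intro: has_vector_derivative_within_subset)
      from bounded_linear.has_vector_derivative[OF bounded_linear_inner_left this, of w]
      show "((\<lambda>t. pv t \<bullet> w) has_real_derivative (- (adjoint_q L r pr \<mu> x \<bullet> w))) (at x within {a..b})"
        by (simp add: has_real_derivative_iff_has_vector_derivative)
    qed
  qed
  have mono: "- (adjoint_q L r pr \<mu> a \<bullet> w) \<le> - (adjoint_q L r pr \<mu> b \<bullet> w)"
    if "0 \<le> a" "a \<le> b" "b \<le> tf" "\<bar>a - t\<bar> < e" "\<bar>b - t\<bar> < e" for a b
  proof -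
    have "AE s in \<mu>. s \<in> {a..<b} \<longrightarrow> 0 \<le> glide_normal L (r s) \<bullet> w"
      using pos by eventually_elim (use that in auto)
    from adjoint_q_antimono[OF that(1-3) this] show ?thesis by simp
  qed
  have acw: "abs_continuous_on 0 tf (\<lambda>t. pv t \<bullet> w)" by (rule abs_continuous_on_inner_left[OF ac(5)])
  have "pv t \<bullet> w + k * (s - t) \<le> pv s \<bullet> w"
  proof (cases "t \<le> s")
    case True
    have "k * (s - t) \<le> pv s \<bullet> w - pv t \<bullet> w"
    proof (rule abs_continuous_on_AE_deriv_ge[OF abs_continuous_on_subinterval[OF acw] True])
      have "AE x in lebesgue. x \<in> {t..s} \<longrightarrow>
          ((\<lambda>t. pv t \<bullet> w) has_real_derivative (- (adjoint_q L r pr \<mu> x \<bullet> w))) (at x within {t..s})"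
        by (rule der) (use t s in auto)
      then show "AE x in lebesgue. x \<in> {t..s} \<longrightarrow>
          (\<exists>D\<ge>k. ((\<lambda>t. pv t \<bullet> w) has_real_derivative D) (at x within {t..s}))"
      proof (eventually_elim, intro impI)
        fix x assume "x \<in> {t..s} \<longrightarrow>
          ((\<lambda>t. pv t \<bullet> w) has_real_derivative (- (adjoint_q L r pr \<mu> x \<bullet> w))) (at x within {t..s})"
          "x \<in> {t..s}"
        moreover from this have "k \<le> - (adjoint_q L r pr \<mu> x \<bullet> w)"
          unfolding k_def using t s by (intro mono) auto
        ultimately show "\<exists>D\<ge>k. ((\<lambda>t. pv t \<bullet> w) has_real_derivative D) (at x within {t..s})" by blast
      qed
    qed (use t s in auto)
    then show ?thesis by simp
  next
    case False
    have "pv t \<bullet> w - pv s \<bullet> w \<le> k * (t - s)"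
    proof (rule abs_continuous_on_AE_deriv_le[OF abs_continuous_on_subinterval[OF acw]])
      have "AE x in lebesgue. x \<in> {s..t} \<longrightarrow>
          ((\<lambda>t. pv t \<bullet> w) has_real_derivative (- (adjoint_q L r pr \<mu> x \<bullet> w))) (at x within {s..t})"
        by (rule der) (use t s in auto)
      then show "AE x in lebesgue. x \<in> {s..t} \<longrightarrow>
          (\<exists>D\<le>k. ((\<lambda>t. pv t \<bullet> w) has_real_derivative D) (at x within {s..t}))"
      proof (eventually_elim, intro impI)
        fix x assume "x \<in> {s..t} \<longrightarrow>
          ((\<lambda>t. pv t \<bullet> w) has_real_derivative (- (adjoint_q L r pr \<mu> x \<bullet> w))) (at x within {s..t})"
          "x \<in> {s..t}"
        moreover from this have "- (adjoint_q L r pr \<mu> x \<bullet> w) \<le> k"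
          unfolding k_def using t s by (intro mono) auto
        ultimately show "\<exists>D\<le>k. ((\<lambda>t. pv t \<bullet> w) has_real_derivative D) (at x within {s..t})" by blast
      qed
    qed (use t s False in auto)
    then show ?thesis by (simp add: algebra_simps)
  qed
  also have "\<dots> \<le> F s" unfolding F_def by (rule w)
  finally show ?thesis using w(2) by (simp add: k_def)
qed

text \<open>The dynamics force the thrust to have a positive component along every normal of the cone
  at an interior contact point: otherwise gravity would push the trajectory out of the cone.  The
  linear function \<open>\<lambda>p. p \<bullet> vec3 (- tan \<gamma> *\<^sub>R \<omega>) 1\<close> dominates the glide slope function, which
  avoids differentiating the latter at the apex.\<close>

lemma contact_direction_pos:
  assumes t: "0 < t" "t < tf" and contact: "glide_slope L (r t) = 0"
    and reg: "hor (pv t) \<noteq> 0 \<or> pv t $ 3 > norm (pv t) * cos (lp_theta L)"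
    and \<omega>: "norm \<omega> = 1" "tan (lp_gamma L) * (\<omega> \<bullet> hor (r t)) = tan (lp_gamma L) * norm (hor (r t))"
  shows "vec3 (- tan (lp_gamma L) *\<^sub>R \<omega>) 1 \<bullet> d t > 0"
proof (rule ccontr)
  define n where "n = vec3 (- tan (lp_gamma L) *\<^sub>R \<omega>) 1"
  assume "\<not> vec3 (- tan (lp_gamma L) *\<^sub>R \<omega>) 1 \<bullet> d t > 0"
  then have nd: "d t \<bullet> n \<le> 0" by (simp add: n_def inner_commute)
  have cpos: "lp_T L > 0" "lp_g0 L > 0" "lp_me L > 0" using data by (auto simp: landing_data_def)
  \<comment> \<open>Chosen so that \<open>lp_T L / lp_me L * \<eta>\<close> is half of gravity. With
    norm of \<open>u\<close> at most 1 and mass at least \<open>lp_me L\<close>, the acceleration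
    along \<open>n\<close> is then at most \<open>- (lp_g0 L / 2)\<close>.\<close>
  define \<eta> where "\<eta> = lp_g0 L * lp_me L / (2 * lp_T L)"
  have \<eta>: "\<eta> > 0" using cpos by (simp add: \<eta>_def)
  have pv: "(pv \<longlongrightarrow> pv t) (at t within {0..tf})"
    using abs_continuous_on_imp_continuous_on[OF ac(5)] t by (auto simp: continuous_on_def)
  have "(d \<longlongrightarrow> d t) (at t within {0..tf})"
    by (rule cap_direction_tendsto[OF \<theta> pv cap_direction_d _ reg]) (use t in auto)
  then have "((\<lambda>s. d s \<bullet> n) \<longlongrightarrow> d t \<bullet> n) (at t within {0..tf})" by (intro tendsto_intros)
  then have "\<forall>\<^sub>F s in at t within {0..tf}. d s \<bullet> n < \<eta>"
    by (rule order_tendstoD) (use nd \<eta> in simp)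
  then obtain e where e: "e > 0" "\<And>s. s \<in> {0..tf} \<Longrightarrow> s \<noteq> t \<Longrightarrow> \<bar>s - t\<bar> < e \<Longrightarrow> d s \<bullet> n < \<eta>"
    unfolding eventually_at dist_real_def by auto
  \<comment> \<open>Half the radius keeps the closed interval inside the open neighbourhood, and
    clipping keeps it in \<open>{0..tf}\<close> with \<open>t\<close> in its interior.\<close>
  define a b where "a = max 0 (t - e / 2)" and "b = min tf (t + e / 2)"
  have ab: "0 \<le> a" "a < t" "t < b" "b \<le> tf" using t e by (auto simp: a_def b_def)
  have dn: "d s \<bullet> n \<le> \<eta>" if "s \<in> {a..b}" for s
  proof (cases "s = t")
    case False
    have "\<bar>s - t\<bar> < e" using that e(1) by (auto simp: a_def b_def abs_if)
    then show ?thesis using e(2)[of s] that False ab by auto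
  qed (use nd \<eta> in simp)
  have ode: "AE x in lebesgue. x \<in> {a..b} \<longrightarrow> (r has_vector_derivative v x) (at x within {a..b}) \<and>
       (v has_vector_derivative ((lp_T L / m x) *\<^sub>R u x - gravity L)) (at x within {a..b})"
  proof -
    have "AE x in lebesgue. x \<in> {0..tf} \<longrightarrow> (r has_vector_derivative v x) (at x within {0..tf}) \<and>
       (v has_vector_derivative ((lp_T L / m x) *\<^sub>R u x - gravity L)) (at x within {0..tf})"
      using adm unfolding admissible_def by (auto elim: AE_mp)
    then show ?thesis
      by eventually_elim (use ab in \<open>auto intro: has_vector_derivative_within_subset\<close>)
  qed
  note ac' = abs_continuous_on_subinterval[OF abs_continuous_on_inner_left[OF ac(1)] ab(1,4)]
    abs_continuous_on_subinterval[OF abs_continuous_on_inner_left[OF ac(2)] ab(1,4)]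
  have rn: "r x \<bullet> n = r x $ 3 - tan (lp_gamma L) * (\<omega> \<bullet> hor (r x))" for x
    by (simp add: n_def inner_hor[of "r x"] inner_commute)
  show False
  proof (rule interior_zero_contradicts_concavity[OF ac'[of n] ab(2,3)])
    show "lp_g0 L / 2 > 0" using cpos by simp
    show "AE x in lebesgue. x \<in> {a..b} \<longrightarrow>
        ((\<lambda>t. r t \<bullet> n) has_real_derivative v x \<bullet> n) (at x within {a..b})"
      using ode by eventually_elim
        (auto simp: has_real_derivative_iff_has_vector_derivative
          intro: bounded_linear.has_vector_derivative[OF bounded_linear_inner_left])
    show "AE x in lebesgue. x \<in> {a..b} \<longrightarrow> (\<exists>D\<le>- (lp_g0 L / 2).
        ((\<lambda>t. v t \<bullet> n) has_real_derivative D) (at x within {a..b}))"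
      using ode
    proof (eventually_elim, intro impI)
      fix x assume x: "x \<in> {a..b} \<longrightarrow> (r has_vector_derivative v x) (at x within {a..b}) \<and>
       (v has_vector_derivative ((lp_T L / m x) *\<^sub>R u x - gravity L)) (at x within {a..b})" "x \<in> {a..b}"
      define D where "D = ((lp_T L / m x) *\<^sub>R u x - gravity L) \<bullet> n"
      have x': "x \<in> {0..tf}" using x ab by auto
      have "((\<lambda>t. v t \<bullet> n) has_real_derivative D) (at x within {a..b})"
        using x bounded_linear.has_vector_derivative[OF bounded_linear_inner_left, of v _ _ n]
        by (auto simp: D_def has_real_derivative_iff_has_vector_derivative)
      moreover have "D \<le> - (lp_g0 L / 2)"
      proof -
        have "u x \<bullet> n = norm (u x) * (d x \<bullet> n)" using u_eq[OF x'] by (metis inner_scaleR_left)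
        also have "\<dots> \<le> norm (u x) * \<eta>" using dn[OF x(2)] by (intro mult_left_mono) auto
        also have "\<dots> \<le> \<eta>" using norm_u_le[OF x'] \<eta> by (intro mult_left_le_one_le) auto
        finally have "lp_T L / m x * (u x \<bullet> n) \<le> lp_T L / m x * \<eta>"
          using cpos mass_pos[OF x'] by (intro mult_left_mono) auto
        also have "\<dots> \<le> lp_T L / lp_me L * \<eta>"
          using cpos mass_pos[OF x'] mass_ge[OF x'] \<eta>
          by (intro mult_right_mono divide_left_mono) auto
        also have "\<dots> = lp_g0 L / 2" using cpos by (simp add: \<eta>_def)
        finally have "lp_T L / m x * (u x \<bullet> n) \<le> lp_g0 L / 2" .
        moreover have "gravity L \<bullet> n = lp_g0 L" by (simp add: inner_hor[of "gravity L"] n_def)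
        ultimately show ?thesis unfolding D_def inner_diff_left inner_scaleR_left by linarith
      qed
      ultimately show "\<exists>D\<le>- (lp_g0 L / 2). ((\<lambda>t. v t \<bullet> n) has_real_derivative D) (at x within {a..b})"
        by blast
    qed
    show "r x \<bullet> n \<ge> 0" if "x \<in> {a..b}" for x
    proof -
      have "glide_slope L (r x) \<ge> 0" using adm that ab by (auto simp: admissible_def)
      moreover have "tan (lp_gamma L) * (\<omega> \<bullet> hor (r x)) \<le> tan (lp_gamma L) * norm (hor (r x))"
        using tan_\<gamma> norm_cauchy_schwarz[of \<omega> "hor (r x)"] \<omega>(1) by (intro mult_left_mono) auto
      ultimately show ?thesis by (simp add: rn glide_slope_def)
    qed
    \<comment> \<open>The condition on \<omega> is equality in Cauchy-Schwarz, weighted by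
      \<open>tan \<gamma>\<close>: the linear function meets the glide slope function exactly at
      this contact point.\<close>
    show "r t \<bullet> n = 0" using contact by (simp only: rn glide_slope_def \<omega>(2))
  qed
qed

text \<open>Away from the apex, or rather whenever \<open>hor (r t)\<close> is nonzero, the normal
  is continuous near \<open>t\<close> and its positive product with \<open>d t\<close> persists. At
  the apex continuity fails, but every horizontal unit vector \<omega> then qualifies in
  \<open>contact_direction_pos\<close>, which covers the normals at all positions at once. The flat
  cone \<open>tan \<gamma> = 0\<close> is handled in the same way.\<close>

lemma contact_normal_nonneg:
  assumes t: "0 < t" "t < tf" and contact: "glide_slope L (r t) = 0"
    and reg: "hor (pv t) \<noteq> 0 \<or> pv t $ 3 > norm (pv t) * cos (lp_theta L)"
  obtains e where "e > 0" "\<And>s. s \<in> {0..tf} \<Longrightarrow> \<bar>s - t\<bar> < e \<Longrightarrow> 0 \<le> glide_normal L (r s) \<bullet> d t"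
proof (cases "tan (lp_gamma L) = 0 \<or> hor (r t) = 0")
  case True
  then have pos: "vec3 (- tan (lp_gamma L) *\<^sub>R \<omega>) 1 \<bullet> d t > 0" if "norm \<omega> = 1" for \<omega>
    by (intro contact_direction_pos[OF t contact reg that]) auto
  have "0 \<le> glide_normal L p \<bullet> d t" for p
  proof (cases "hor p = 0")
    case False
    then have "norm (hor p /\<^sub>R norm (hor p)) = 1" by simp
    from pos[OF this] show ?thesis by (simp add: glide_normal_def)
  next
    case True
    \<comment> \<open>On the axis the conventional normal is vertical, which is the mean of the
      normals belonging to \<omega> and to its negative.\<close>
    obtain \<omega> :: "real^2" where \<omega>: "norm \<omega> = 1" using vector_choose_size[of 1] by auto
    have "vec3 (- tan (lp_gamma L) *\<^sub>R \<omega>) 1 \<bullet> d t > 0" "vec3 (- tan (lp_gamma L) *\<^sub>R (- \<omega>)) 1 \<bullet> d t > 0"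
      using pos[of \<omega>] pos[of "- \<omega>"] \<omega> by simp_all
    then show ?thesis using True by (simp add: glide_normal_def inner_hor[of _ "d t"])
  qed
  then show ?thesis by (intro that[of 1]) auto
next
  case False
  then have ht: "hor (r t) \<noteq> 0" by simp
  have r: "(r \<longlongrightarrow> r t) (at t within {0..tf})"
    using abs_continuous_on_imp_continuous_on[OF ac(1)] t by (auto simp: continuous_on_def)
  have hr: "((\<lambda>s. hor (r s)) \<longlongrightarrow> hor (r t)) (at t within {0..tf})"
    by (rule bounded_linear.tendsto[OF linear_hor[unfolded linear_conv_bounded_linear] r])
  have lim: "((\<lambda>s. (- tan (lp_gamma L) *\<^sub>R (hor (r s) /\<^sub>R norm (hor (r s)))) \<bullet> hor (d t) + d t $ 3)
      \<longlongrightarrow> (- tan (lp_gamma L) *\<^sub>R (hor (r t) /\<^sub>R norm (hor (r t)))) \<bullet> hor (d t) + d t $ 3)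
      (at t within {0..tf})"
    by (intro tendsto_intros hr) (use ht in simp)
  have "norm (hor (r t) /\<^sub>R norm (hor (r t))) = 1" using ht by simp
  then have pos: "vec3 (- tan (lp_gamma L) *\<^sub>R (hor (r t) /\<^sub>R norm (hor (r t)))) 1 \<bullet> d t > 0"
    by (rule contact_direction_pos[OF t contact reg])
      (use ht in \<open>simp add: power2_norm_eq_inner[symmetric] power2_eq_square\<close>)
  have eq: "glide_normal L p \<bullet> d t
      = (- tan (lp_gamma L) *\<^sub>R (hor p /\<^sub>R norm (hor p))) \<bullet> hor (d t) + d t $ 3" for p
    unfolding glide_normal_def inner_hor[of _ "d t"] hor_vec3 vec3_nth by simp
  have "\<forall>\<^sub>F s in at t within {0..tf}. 0 < glide_normal L (r s) \<bullet> d t"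
    unfolding eq using lim by (rule order_tendstoD)
      (use pos in \<open>simp only: eq[symmetric] glide_normal_def\<close>)
  then obtain e where e: "e > 0"
    "\<And>s. s \<in> {0..tf} \<Longrightarrow> s \<noteq> t \<Longrightarrow> \<bar>s - t\<bar> < e \<Longrightarrow> 0 < glide_normal L (r s) \<bullet> d t"
    unfolding eventually_at dist_real_def by auto
  have "0 < glide_normal L (r t) \<bullet> d t" using pos by (simp only: glide_normal_def)
  then show ?thesis using e by (intro that[of e]) (auto intro: less_imp_le)
qed

section \<open>Convexity along the extremal\<close>

lemma continuous_on_F: "continuous_on {0..tf} F"
  unfolding F_def[abs_def] by (intro continuous_on_cap_support \<theta> abs_continuous_on_imp_continuous_on ac)

lemma convex_F: "convex_on {0..tf} F"
proof (rule convex_on_local_affine_support)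
  show "continuous_on {0..tf} F" by (rule continuous_on_F)
next
  fix t assume t: "0 < t" "t < tf"
  then have t': "t \<in> {0..tf}" by simp
  have "\<exists>w. \<exists>e>0. (\<forall>p. p \<bullet> w \<le> cap_support (lp_theta L) p) \<and> pv t \<bullet> w = F t \<and>
      (AE s in \<mu>. \<bar>s - t\<bar> < e \<longrightarrow> 0 \<le> glide_normal L (r s) \<bullet> w)"
  proof (cases "glide_slope L (r t) = 0")
    case False
    obtain e where e: "e > 0" "AE s in \<mu>. \<not> \<bar>s - t\<bar> < e"
      using noncontact_null[OF t' False] .
    obtain w where w: "norm w = 1" "cos (lp_theta L) \<le> w $ 3" "pv t \<bullet> w = F t"
      using cap_support_attained[OF \<theta>] unfolding F_def by metis
    have "AE s in \<mu>. \<bar>s - t\<bar> < e \<longrightarrow> 0 \<le> glide_normal L (r s) \<bullet> w"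
      using e(2) by eventually_elim simp
    then show ?thesis using e(1) w inner_le_cap_support[OF \<theta> w(1,2)] by blast
  next
    case contact: True
    show ?thesis
    \<comment> \<open>The negation leaves a vertical \<open>pv t\<close> that is not strictly inside
      the cone: zero, pointing downwards, or pointing upwards with \<theta> = 0.\<close>
    proof (cases "hor (pv t) \<noteq> 0 \<or> pv t $ 3 > norm (pv t) * cos (lp_theta L)")
      case reg: True
      then have "pv t \<noteq> 0" using linear_0[OF linear_hor] by auto
      then have d: "cos (lp_theta L) \<le> d t $ 3" "norm (d t) = 1" "pv t \<bullet> d t = F t"
        using cap_direction_vertical[OF cap_direction_d[OF t']] cap_direction_d[OF t']
          cap_direction_inner[OF cap_direction_d[OF t']] by (auto simp: F_def cap_direction_def)
      obtain e where e: "e > 0"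
        "\<And>s. s \<in> {0..tf} \<Longrightarrow> \<bar>s - t\<bar> < e \<Longrightarrow> 0 \<le> glide_normal L (r s) \<bullet> d t"
        using contact_normal_nonneg[OF t contact reg] by blast
      have "AE s in \<mu>. \<bar>s - t\<bar> < e \<longrightarrow> 0 \<le> glide_normal L (r s) \<bullet> d t"
        using e(2) by (intro AE_I2) (auto simp: space_\<mu>)
      then show ?thesis using e(1) d inner_le_cap_support[OF \<theta> d(2,1)] by blast
    next
      case irreg: False
      \<comment> \<open>The maximizing direction may jump at \<open>t\<close>, but the vertical average \<open>w\<close> of the maximizing
        directions has a nonnegative product with every normal.\<close>
      define w where "w = cos (lp_theta L) *\<^sub>R e_z"
      have "p \<bullet> w \<le> cap_support (lp_theta L) p" for p
        using vertical_le_cap_support[OF \<theta>, of p] by (simp add: w_def)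
      moreover have "pv t \<bullet> w = F t"
      \<comment> \<open>In the first case \<open>pv t\<close> is zero, or it points upwards and
        \<theta> = 0; either way both branches of \<open>cap_support\<close> give the same
        value.\<close>
      proof (cases "norm (pv t) * cos (lp_theta L) \<le> pv t $ 3")
        case True
        then have eq: "pv t $ 3 = norm (pv t) * cos (lp_theta L)" using irreg by simp
        then have "pv t $ 3 \<ge> 0" using cos_\<theta> by simp
        moreover have "(norm (pv t))\<^sup>2 = (pv t $ 3)\<^sup>2" using irreg norm_hor_sq[of "pv t"] by simp
        ultimately have "norm (pv t) = pv t $ 3" using norm_ge_zero power2_eq_imp_eq by blast
        moreover have "pv t \<bullet> w = pv t $ 3 * cos (lp_theta L)" by (simp add: w_def)
        moreover have "F t = norm (pv t)" using True by (simp add: F_def cap_support_def)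
        ultimately show ?thesis using eq by metis
      next
        case False
        then show ?thesis using irreg by (simp add: w_def F_def cap_support_def)
      qed
      moreover have "0 \<le> glide_normal L (r s) \<bullet> w" for s
        using cos_\<theta> by (simp add: w_def glide_normal_def)
      ultimately show ?thesis by (intro exI[of _ w] exI[of _ 1]) auto
    qed
  qed
  then obtain w e where "e > 0" and w: "\<And>p. p \<bullet> w \<le> cap_support (lp_theta L) p" "pv t \<bullet> w = F t"
      "AE s in \<mu>. \<bar>s - t\<bar> < e \<longrightarrow> 0 \<le> glide_normal L (r s) \<bullet> w" by blast
  then show "\<exists>k. \<exists>e>0. \<forall>s\<in>{0..tf}. \<bar>s - t\<bar> < e \<longrightarrow> F t + k * (s - t) \<le> F s"
    using local_affine_support[OF t' w] by blast
qed

subsection \<open>The switching function\<close>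

definition \<Psi> :: "real \<Rightarrow> real"
  where "\<Psi> = switching_function L m pv pm d"

text \<open>Replacing \<open>d\<close> by \<open>F\<close> makes \<Psi> continuous, and the
  reciprocal of the mass is isolated for the cancellation below.\<close>

lemma \<Psi>_eq: "t \<in> {0..tf} \<Longrightarrow> \<Psi> t = lp_T L * F t * inverse (m t) - lp_q L * pm t"
  using cap_direction_inner[OF cap_direction_d]
  by (simp add: \<Psi>_def switching_function_def F_def divide_inverse)

lemma continuous_on_\<Psi>: "continuous_on {0..tf} \<Psi>"
proof -
  have "m t \<noteq> 0" if "t \<in> {0..tf}" for t using mass_pos[OF that] by simp
  then have "continuous_on {0..tf} (\<lambda>t. lp_T L * F t * inverse (m t) - lp_q L * pm t)"
    by (intro continuous_intros continuous_on_F abs_continuous_on_imp_continuous_on ac) auto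
  then show ?thesis by (subst continuous_on_cong[OF refl \<Psi>_eq]) auto
qed

text \<open>The differentiated function is minus the switching function with \<open>F\<close> frozen
  at the value \<open>c\<close>. The terms from the mass and from \<open>pm\<close> combine into a
  multiple of \<open>F t - c\<close>; at \<open>c = F t\<close> they cancel.\<close>

lemma mass_costate_derivative:
  assumes "0 \<le> a" "b \<le> tf"
  shows "AE t in lebesgue. t \<in> {a..b} \<longrightarrow>
    ((\<lambda>t. lp_q L * pm t + (- lp_T L * c) * inverse (m t)) has_real_derivative
      lp_q L * lp_T L * norm (u t) / (m t)\<^sup>2 * (F t - c)) (at t within {a..b})"
proof -
  have "AE t in lebesgue. t \<in> {0..tf} \<longrightarrow>
      (m has_real_derivative (- lp_q L * norm (u t))) (at t within {0..tf})"
    using adm unfolding admissible_def by (auto elim: AE_mp)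
  moreover have "AE t in lebesgue. t \<in> {0..tf} \<longrightarrow>
      (pm has_real_derivative (lp_T L / (m t)\<^sup>2 * (pv t \<bullet> u t))) (at t within {0..tf})"
    using pmp unfolding pmp_multipliers_def by (auto elim: AE_mp)
  ultimately show ?thesis
  proof (eventually_elim, intro impI)
    fix t assume der: "t \<in> {0..tf} \<longrightarrow>
        (m has_real_derivative (- lp_q L * norm (u t))) (at t within {0..tf})"
      "t \<in> {0..tf} \<longrightarrow>
        (pm has_real_derivative (lp_T L / (m t)\<^sup>2 * (pv t \<bullet> u t))) (at t within {0..tf})"
      "t \<in> {a..b}"
    have t: "t \<in> {0..tf}" "{a..b} \<subseteq> {0..tf}" using der(3) assms by auto
    have m: "(m has_real_derivative (- lp_q L * norm (u t))) (at t within {a..b})"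
      and pm: "(pm has_real_derivative (lp_T L / (m t)\<^sup>2 * (norm (u t) * F t))) (at t within {a..b})"
      using der t has_field_derivative_subset inner_u[OF t(1)] by metis+
    have "m t \<noteq> 0" using mass_pos[OF t(1)] by simp
    note DERIV_inverse'[OF m this]
    then have "((\<lambda>t. lp_q L * pm t + (- lp_T L * c) * inverse (m t)) has_real_derivative
      lp_q L * (lp_T L / (m t)\<^sup>2 * (norm (u t) * F t))
      + (- lp_T L * c) * - (inverse (m t) * (- lp_q L * norm (u t)) * inverse (m t))) (at t within {a..b})"
      by (intro DERIV_add DERIV_cmult pm)
    moreover have "lp_q L * (lp_T L / (m t)\<^sup>2 * (norm (u t) * F t))
      + (- lp_T L * c) * - (inverse (m t) * (- lp_q L * norm (u t)) * inverse (m t))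
      = lp_q L * lp_T L * norm (u t) / (m t)\<^sup>2 * (F t - c)"
      by (simp add: power2_eq_square divide_inverse algebra_simps)
    ultimately show "((\<lambda>t. lp_q L * pm t + (- lp_T L * c) * inverse (m t)) has_real_derivative
      lp_q L * lp_T L * norm (u t) / (m t)\<^sup>2 * (F t - c)) (at t within {a..b})" by simp
  qed
qed

lemma mass_costate_factor_nonneg: "lp_q L * lp_T L * norm (u t) / (m t)\<^sup>2 \<ge> 0"
  using data by (simp add: landing_data_def)

lemma ac_mass_costate:
  assumes "0 \<le> a" "b \<le> tf"
  shows "abs_continuous_on a b (\<lambda>t. lp_q L * pm t + (- lp_T L * c) * inverse (m t))"
proof (rule abs_continuous_on_subinterval[OF _ assms])
  have "lp_me L > 0" using data by (simp add: landing_data_def)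
  from abs_continuous_on_inverse[OF ac(3) this mass_ge]
  show "abs_continuous_on 0 tf (\<lambda>t. lp_q L * pm t + (- lp_T L * c) * inverse (m t))"
    by (intro abs_continuous_on_linear_combination ac)
qed

text \<open>Formally \<open>\<Psi>' = (T / m) * F'\<close>, since the terms with \<open>m'\<close> and \<open>p_m'\<close> cancel.  Comparing increments
  instead avoids differentiating \<open>F\<close>.\<close>

lemma \<Psi>_increment_ge:
  assumes ab: "0 \<le> a" "a \<le> b" "b \<le> tf" and F: "\<And>s. s \<in> {a..b} \<Longrightarrow> F s \<le> F b"
  shows "lp_T L * inverse (m a) * (F b - F a) \<le> \<Psi> b - \<Psi> a"
proof -
  \<comment> \<open>\<open>F\<close> is frozen at its value at the right endpoint. Then
    \<open>\<Psi> b - \<Psi> a\<close> equals the claimed lower bound minus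
    \<open>G b - G a\<close>, so only the sign of the latter is needed.\<close>
  define G where "G = (\<lambda>t. lp_q L * pm t + (- lp_T L * F b) * inverse (m t))"
  have "G b - G a \<le> 0 * (b - a)"
    unfolding G_def
  proof (rule abs_continuous_on_AE_deriv_le[OF ac_mass_costate[OF ab(1,3)] ab(2)])
    show "AE x in lebesgue. x \<in> {a..b} \<longrightarrow>
       (\<exists>D\<le>0. ((\<lambda>t. lp_q L * pm t + (- lp_T L * F b) * inverse (m t)) has_real_derivative D)
         (at x within {a..b}))"
      using mass_costate_derivative[OF ab(1,3), of "F b"]
      by eventually_elim (use F mass_costate_factor_nonneg in \<open>blast intro: mult_nonneg_nonpos diff_le_0_iff_le[THEN iffD2]\<close>)
  qed
  then have "G b - G a \<le> 0" by simp
  moreover have "a \<in> {0..tf}" "b \<in> {0..tf}" using ab by auto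
  ultimately show ?thesis by (simp add: \<Psi>_eq G_def algebra_simps)
qed

lemma \<Psi>_increment_le:
  assumes ab: "0 \<le> a" "a \<le> b" "b \<le> tf" and F: "\<And>s. s \<in> {a..b} \<Longrightarrow> F b \<le> F s"
  shows "\<Psi> b - \<Psi> a \<le> lp_T L * inverse (m a) * (F b - F a)"
proof -
  define G where "G = (\<lambda>t. lp_q L * pm t + (- lp_T L * F b) * inverse (m t))"
  have "0 * (b - a) \<le> G b - G a"
    unfolding G_def
  proof (rule abs_continuous_on_AE_deriv_ge[OF ac_mass_costate[OF ab(1,3)] ab(2)])
    show "AE x in lebesgue. x \<in> {a..b} \<longrightarrow>
       (\<exists>D\<ge>0. ((\<lambda>t. lp_q L * pm t + (- lp_T L * F b) * inverse (m t)) has_real_derivative D)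
         (at x within {a..b}))"
      using mass_costate_derivative[OF ab(1,3), of "F b"]
      by eventually_elim (use F mass_costate_factor_nonneg in \<open>blast intro: mult_nonneg_nonneg diff_ge_0_iff_ge[THEN iffD2]\<close>)
  qed
  then have "0 \<le> G b - G a" by simp
  moreover have "a \<in> {0..tf}" "b \<in> {0..tf}" using ab by auto
  ultimately show ?thesis by (simp add: \<Psi>_eq G_def algebra_simps)
qed

section \<open>The maximum condition\<close>

text \<open>The competitor is \<rho> times a maximizing direction of the cap. Up to a common term
  independent of the control, the Hamiltonian is \<open>\<rho> * \<Psi> t\<close> there and
  \<open>norm (u t) * \<Psi> t\<close> at the actual control.\<close>

lemma hamiltonian_maximal:
  assumes t: "t \<in> {0..tf}"
    and max: "hamiltonian L (r t, v t, m t) (q, pv t, pm t) (u t) p0 =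
       (SUP w\<in>control_set L. hamiltonian L (r t, v t, m t) (q, pv t, pm t) w p0)"
    and \<rho>: "lp_umin L \<le> \<rho>" "\<rho> \<le> lp_umax L"
  shows "\<rho> * \<Psi> t \<le> norm (u t) * \<Psi> t"
proof -
  obtain w where w: "norm w = 1" "cos (lp_theta L) \<le> w $ 3" "pv t \<bullet> w = F t"
    using cap_support_attained[OF \<theta>] unfolding F_def by metis
  have umin: "0 \<le> lp_umin L" and umax: "lp_umax L \<le> 1" using data by (auto simp: landing_data_def)
  define base where "base = q \<bullet> v t - pv t \<bullet> gravity L"
  have ham: "hamiltonian L (r t, v t, m t) (q, pv t, pm t) x p0
      = base + (lp_T L / m t * (pv t \<bullet> x) - lp_q L * pm t * norm x)" for x
    by (simp add: base_def inner_diff_right)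
  have \<rho>w: "\<rho> *\<^sub>R w \<in> control_set L"
    using \<rho> umin w by (auto simp: control_set_def mult_left_mono)
  have "hamiltonian L (r t, v t, m t) (q, pv t, pm t) (\<rho> *\<^sub>R w) p0
      \<le> hamiltonian L (r t, v t, m t) (q, pv t, pm t) (u t) p0"
    unfolding max
  proof (rule cSUP_upper[OF \<rho>w])
    \<comment> \<open>A supremum of reals dominates the members only of a set that is bounded
      above.\<close>
    show "bdd_above ((\<lambda>w. hamiltonian L (r t, v t, m t) (q, pv t, pm t) w p0) ` control_set L)"
    proof (rule bdd_aboveI2)
      fix x assume "x \<in> control_set L"
      then have x: "norm x \<le> 1" using umax by (auto simp: control_set_def)
      have "\<bar>lp_T L / m t * (pv t \<bullet> x)\<bar> \<le> \<bar>lp_T L / m t\<bar> * (norm (pv t) * 1)"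
        unfolding abs_mult using x Cauchy_Schwarz_ineq2[of "pv t" x]
          mult_left_mono[OF x norm_ge_zero[of "pv t"]]
        by (intro mult_left_mono) auto
      moreover have "\<bar>lp_q L * pm t * norm x\<bar> \<le> \<bar>lp_q L * pm t\<bar> * 1"
        unfolding abs_mult[of _ "norm x"] using x by (intro mult_left_mono) auto
      ultimately show "hamiltonian L (r t, v t, m t) (q, pv t, pm t) x p0
          \<le> base + \<bar>lp_T L / m t\<bar> * (norm (pv t) * 1) + \<bar>lp_q L * pm t\<bar> * 1"
        unfolding ham by linarith
    qed
  qed
  then show ?thesis
    using \<rho> umin w(1,3) inner_u[OF t] unfolding ham \<Psi>_eq[OF t]
    by (simp add: divide_inverse algebra_simps)
qed

lemma AE_norm_control:
  "AE t in lebesgue. t \<in> {0..tf} \<longrightarrow>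
    (\<Psi> t > 0 \<longrightarrow> norm (u t) = lp_umax L) \<and> (\<Psi> t < 0 \<longrightarrow> norm (u t) = lp_umin L)"
proof -
  have "AE t in lebesgue. t \<in> {0..tf} \<longrightarrow>
      hamiltonian L (r t, v t, m t) (adjoint_q L r pr \<mu> t, pv t, pm t) (u t) p0 =
      (SUP w\<in>control_set L. hamiltonian L (r t, v t, m t) (adjoint_q L r pr \<mu> t, pv t, pm t) w p0)"
    using pmp unfolding pmp_multipliers_def by blast
  then show ?thesis
  proof (eventually_elim, intro impI)
    fix t assume max: "t \<in> {0..tf} \<longrightarrow>
      hamiltonian L (r t, v t, m t) (adjoint_q L r pr \<mu> t, pv t, pm t) (u t) p0 =
      (SUP w\<in>control_set L. hamiltonian L (r t, v t, m t) (adjoint_q L r pr \<mu> t, pv t, pm t) w p0)"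
      and t: "t \<in> {0..tf}"
    have u: "lp_umin L \<le> norm (u t)" "norm (u t) \<le> lp_umax L" "lp_umin L \<le> lp_umax L"
      using u_in[OF t] data by (auto simp: control_set_def landing_data_def)
    have le: "lp_umax L * \<Psi> t \<le> norm (u t) * \<Psi> t" "lp_umin L * \<Psi> t \<le> norm (u t) * \<Psi> t"
      using hamiltonian_maximal[OF t max[rule_format, OF t]] u(3) by auto
    show "(\<Psi> t > 0 \<longrightarrow> norm (u t) = lp_umax L) \<and> (\<Psi> t < 0 \<longrightarrow> norm (u t) = lp_umin L)"
      using le u by (auto simp: mult_le_cancel_right)
  qed
qed

section \<open>Sign pattern of the switching function\<close>

text \<open>The chord is drawn from the minimizer \<open>c\<close> to the farther point. The nearer
  point lies a proper fraction of the way along it, so its excess over \<open>F c\<close> is at most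
  that fraction of the farther excess, hence strictly smaller once it is positive.\<close>

lemma F_decreasing_then_increasing:
  assumes c: "c \<in> {0..tf}" "\<And>s. s \<in> {0..tf} \<Longrightarrow> F c \<le> F s"
  shows "c \<le> s \<Longrightarrow> s \<le> t \<Longrightarrow> t \<le> tf \<Longrightarrow> F s \<le> F t \<and> (s < t \<longrightarrow> F c < F s \<longrightarrow> F s < F t)"
    and "0 \<le> s \<Longrightarrow> s \<le> t \<Longrightarrow> t \<le> c \<Longrightarrow> F t \<le> F s \<and> (s < t \<longrightarrow> F c < F t \<longrightarrow> F t < F s)"
proof -
  assume st: "c \<le> s" "s \<le> t" "t \<le> tf"
  have min: "F c \<le> F s" "F c \<le> F t" using c st by auto
  show "F s \<le> F t \<and> (s < t \<longrightarrow> F c < F s \<longrightarrow> F s < F t)"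
  proof (cases "c = s \<or> s = t")
    case True
    then show ?thesis using min by auto
  next
    case False
    then have cst: "c < s" "s < t" using st by auto
    have "convex_on {c..t} F" by (rule convex_on_subset[OF convex_F]) (use c st in auto)
    then have "F s \<le> (F t - F c) / (t - c) * (s - c) + F c"
      by (rule convex_onD_Icc') (use st in auto)
    then have chord: "F s - F c \<le> (F t - F c) * ((s - c) / (t - c))" by simp
    have frac: "0 < (s - c) / (t - c)" "(s - c) / (t - c) < 1" using cst by auto
    have "(F t - F c) * ((s - c) / (t - c)) \<le> (F t - F c) * 1"
      using min frac by (intro mult_left_mono) auto
    then have "F s \<le> F t" using chord by simp
    moreover have "F s < F t" if "F c < F s"
    proof -
      have "F c < F t" using that \<open>F s \<le> F t\<close> by simp
      then have "(F t - F c) * ((s - c) / (t - c)) < (F t - F c) * 1"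
        using frac by (intro mult_strict_left_mono) auto
      then show ?thesis using chord by simp
    qed
    ultimately show ?thesis by blast
  qed
next
  assume st: "0 \<le> s" "s \<le> t" "t \<le> c"
  have min: "F c \<le> F s" "F c \<le> F t" using c st by auto
  show "F t \<le> F s \<and> (s < t \<longrightarrow> F c < F t \<longrightarrow> F t < F s)"
  proof (cases "c = t \<or> s = t")
    case True
    then show ?thesis using min by auto
  next
    case False
    then have cst: "s < t" "t < c" using st by auto
    have "convex_on {s..c} F" by (rule convex_on_subset[OF convex_F]) (use c st in auto)
    then have "F t \<le> (F s - F c) / (c - s) * (c - t) + F c"
      by (rule convex_onD_Icc'') (use st in auto)
    then have chord: "F t - F c \<le> (F s - F c) * ((c - t) / (c - s))" by simp
    have frac: "0 < (c - t) / (c - s)" "(c - t) / (c - s) < 1" using cst by auto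
    have "(F s - F c) * ((c - t) / (c - s)) \<le> (F s - F c) * 1"
      using min frac by (intro mult_left_mono) auto
    then have "F t \<le> F s" using chord by simp
    moreover have "F t < F s" if "F c < F t"
    proof -
      have "F c < F s" using that \<open>F t \<le> F s\<close> by simp
      then have "(F s - F c) * ((c - t) / (c - s)) < (F s - F c) * 1"
        using frac by (intro mult_strict_left_mono) auto
      then show ?thesis using chord by simp
    qed
    ultimately show ?thesis by blast
  qed
qed

text \<open>\<open>t1\<close> and \<open>t2\<close> are the extreme points of the set where \<Psi>
  is nonpositive. By monotonicity on both sides of \<open>c\<close> this set is the whole interval
  between them. A zero minimum makes \<Psi> vanish there; a negative one excludes interior zeros,
  though \<Psi> may vanish at the endpoints, hence the open interval.\<close>

lemma control_structure:
  "\<exists>t1 t2. 0 \<le> t1 \<and> t1 \<le> t2 \<and> t2 \<le> tf \<and>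
    (\<forall>t\<in>{0..<t1} \<union> {t2<..tf}. t \<noteq> 0 \<longrightarrow> \<Psi> t > 0) \<and>
    ((\<forall>t\<in>{t1<..<t2}. \<Psi> t < 0) \<or> (\<forall>t\<in>{t1..t2}. \<Psi> t = 0))"
proof -
  have tf: "0 \<le> tf" using adm by (simp add: admissible_def)
  obtain c where c: "c \<in> {0..tf}" "\<And>s. s \<in> {0..tf} \<Longrightarrow> F c \<le> F s"
    using continuous_attains_inf[OF _ _ continuous_on_F] tf by auto
  have F_incr: "F s \<le> F t \<and> (s < t \<longrightarrow> F c < F s \<longrightarrow> F s < F t)" if "c \<le> s" "s \<le> t" "t \<le> tf" for s t
    by (rule F_decreasing_then_increasing(1)[OF c(1) _ that]) (rule c(2))
  have F_decr: "F t \<le> F s \<and> (s < t \<longrightarrow> F c < F t \<longrightarrow> F t < F s)" if "0 \<le> s" "s \<le> t" "t \<le> c" for s t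
    by (rule F_decreasing_then_increasing(2)[OF c(1) _ that]) (rule c(2))
  have factor: "lp_T L * inverse (m a) > 0" if "a \<in> {0..tf}" for a
    using mass_pos[OF that] data by (simp add: landing_data_def)
  have incr: "\<Psi> s \<le> \<Psi> t \<and> (F s < F t \<longrightarrow> \<Psi> s < \<Psi> t)" if "c \<le> s" "s \<le> t" "t \<le> tf" for s t
  proof -
    have s: "0 \<le> s" "s \<in> {0..tf}" using that c by auto
    have "lp_T L * inverse (m s) * (F t - F s) \<le> \<Psi> t - \<Psi> s"
      by (rule \<Psi>_increment_ge[OF s(1) that(2,3)]) (use F_incr that in auto)
    moreover have "F t - F s \<ge> 0" using F_incr[OF that] by simp
    ultimately show ?thesis using factor[OF s(2)]
      by (smt (verit) mult_nonneg_nonneg mult_pos_pos)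
  qed
  have decr: "\<Psi> t \<le> \<Psi> s \<and> (F t < F s \<longrightarrow> \<Psi> t < \<Psi> s)" if "0 \<le> s" "s \<le> t" "t \<le> c" for s t
  proof -
    have s: "s \<in> {0..tf}" "t \<le> tf" using that c by auto
    have "\<Psi> t - \<Psi> s \<le> lp_T L * inverse (m s) * (F t - F s)"
      by (rule \<Psi>_increment_le[OF that(1,2) s(2)]) (use F_decr that in auto)
    moreover have "F s - F t \<ge> 0" using F_decr[OF that] by simp
    moreover have "lp_T L * inverse (m s) * (F t - F s) = - (lp_T L * inverse (m s) * (F s - F t))"
      by (simp add: algebra_simps)
    ultimately show ?thesis using factor[OF s(1)]
      by (smt (verit) mult_nonneg_nonneg mult_pos_pos)
  qed
  have min: "\<Psi> c \<le> \<Psi> t" if "t \<in> {0..tf}" for t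
    using incr[of c t] decr[of t c] that c by (cases "t \<le> c") auto
  show ?thesis
  proof (cases "\<Psi> c > 0")
    case True
    then have "\<Psi> t > 0" if "t \<in> {0..tf}" for t using min[OF that] by simp
    \<comment> \<open>With \<open>t1 = t2 = 0\<close> the open middle interval is empty and the
      negative alternative holds vacuously.\<close>
    then show ?thesis using tf by (intro exI[of _ 0]) auto
  next
    case False
    define Z where "Z = {0..tf} \<inter> \<Psi> -` {..0}"
    have "closed Z" unfolding Z_def by (rule continuous_closed_preimage[OF continuous_on_\<Psi>]) auto
    then have Z: "compact Z" unfolding Z_def by (simp add: bounded_Int compact_eq_bounded_closed)
    have cZ: "c \<in> Z" using c False by (simp add: Z_def)
    obtain t1 where t1: "t1 \<in> Z" "\<And>t. t \<in> Z \<Longrightarrow> t1 \<le> t" using compact_attains_inf[OF Z] cZ by blast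
    obtain t2 where t2: "t2 \<in> Z" "\<And>t. t \<in> Z \<Longrightarrow> t \<le> t2" using compact_attains_sup[OF Z] cZ by blast
    have ord: "0 \<le> t1" "t1 \<le> c" "c \<le> t2" "t2 \<le> tf" and \<Psi>12: "\<Psi> t1 \<le> 0" "\<Psi> t2 \<le> 0"
      using t1 t2 cZ by (auto simp: Z_def)
    have out: "\<Psi> t > 0" if "t \<in> {0..<t1} \<union> {t2<..tf}" for t
    proof (rule ccontr)
      assume "\<not> \<Psi> t > 0"
      then have "t \<in> Z" using that ord by (auto simp: Z_def)
      then show False using t1(2)[of t] t2(2)[of t] that by auto
    qed
    have nonpos: "\<Psi> t \<le> 0" if "t \<in> {t1..t2}" for t
      using incr[of t t2] decr[of t1 t] that ord \<Psi>12 by (cases "t \<le> c") auto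
    have "(\<forall>t\<in>{t1<..<t2}. \<Psi> t < 0) \<or> (\<forall>t\<in>{t1..t2}. \<Psi> t = 0)"
    proof (cases "\<Psi> c = 0")
      case True
      have "\<Psi> t = 0" if "t \<in> {t1..t2}" for t
        using nonpos[OF that] min[of t] that ord True by auto
      then show ?thesis by blast
    next
      case neg: False
      have "\<Psi> t < 0" if t: "t1 < t" "t < t2" for t
      proof (rule ccontr)
        assume "\<not> \<Psi> t < 0"
        then have "\<Psi> t = 0" using nonpos[of t] t by auto
        then have gt: "\<Psi> c < \<Psi> t" using neg False by simp
        then have tc: "t \<noteq> c" by auto
        show False
        proof (cases "c < t")
          case True
          have ct: "0 \<le> c" "c \<le> t" "t \<le> tf" using True t ord by auto
          \<comment> \<open>Otherwise \<open>F\<close> would attain its minimum at \<open>t\<close>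
            too, and the increment estimate would give \<open>\<Psi> t \<le> \<Psi> c\<close>.
            Beyond the minimal set \<open>F\<close>, and with it \<Psi>, increases strictly, so a
            zero at \<open>t\<close> contradicts nonpositivity at \<open>t2\<close>. The other side
            is the mirror image with \<open>t1\<close>.\<close>
          have "F c < F t"
          proof (rule ccontr)
            assume "\<not> F c < F t"
            then have eq: "F t = F c" using c(2)[of t] ct by auto
            have "\<Psi> t - \<Psi> c \<le> lp_T L * inverse (m c) * (F t - F c)"
              by (rule \<Psi>_increment_le[OF ct]) (use c(2) ct eq in auto)
            then show False using gt eq by simp
          qed
          then have "F t < F t2" using F_incr[of t t2] t ct ord by auto
          then have "\<Psi> t < \<Psi> t2" using incr[of t t2] t ct ord by auto
          then show False using \<Psi>12 \<open>\<Psi> t = 0\<close> by simp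
        next
          case False
          then have ct: "0 \<le> t" "t \<le> c" "c \<le> tf" using tc t ord by auto
          have "F c < F t"
          proof (rule ccontr)
            assume "\<not> F c < F t"
            then have eq: "F t = F c" using c(2)[of t] ct by auto
            have "lp_T L * inverse (m t) * (F c - F t) \<le> \<Psi> c - \<Psi> t"
            proof (rule \<Psi>_increment_ge[OF ct])
              fix s assume "s \<in> {t..c}"
              then show "F s \<le> F c" using F_decr[of t s] ct eq by auto
            qed
            then show False using gt eq by simp
          qed
          then have "F t < F t1" using F_decr[of t1 t] t ct ord by auto
          then have "\<Psi> t < \<Psi> t1" using decr[of t1 t] t ct ord by auto
          then show False using \<Psi>12 \<open>\<Psi> t = 0\<close> by simp
        qed
      qed
      then show ?thesis by auto
    qed
    then show ?thesis using ord out by (intro exI[of _ t1] exI[of _ t2]) auto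
  qed
qed

lemma max_min_max_or_max_singular_max:
  "\<exists>t1 t2. 0 \<le> t1 \<and> t1 \<le> t2 \<and> t2 \<le> tf \<and>
    (AE t\<in>{0..<t1} \<union> {t2<..tf} in lebesgue. norm (u t) = lp_umax L) \<and>
    ((AE t\<in>{t1..t2} in lebesgue. norm (u t) = lp_umin L) \<or>
     (\<forall>t\<in>{t1..t2}. switching_function L m pv pm d t = 0))"
proof -
  obtain t1 t2 where ord: "0 \<le> t1" "t1 \<le> t2" "t2 \<le> tf"
    and out: "\<And>t. t \<in> {0..<t1} \<union> {t2<..tf} \<Longrightarrow> t \<noteq> 0 \<Longrightarrow> \<Psi> t > 0"
    and ins: "(\<forall>t\<in>{t1<..<t2}. \<Psi> t < 0) \<or> (\<forall>t\<in>{t1..t2}. \<Psi> t = 0)"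
    using control_structure by blast
  \<comment> \<open>Single points are null, which disposes of the endpoints where the sign of \<Psi>
    is left open.\<close>
  have ne: "AE t in lebesgue. t \<noteq> x" for x :: real
    by (rule AE_I'[of "{x}"]) auto
  have "AE t\<in>{0..<t1} \<union> {t2<..tf} in lebesgue. norm (u t) = lp_umax L"
    using AE_norm_control ne[of 0]
  proof eventually_elim
    case (elim t)
    then show ?case using out[of t] ord by auto
  qed
  moreover have "AE t\<in>{t1..t2} in lebesgue. norm (u t) = lp_umin L" if "\<forall>t\<in>{t1<..<t2}. \<Psi> t < 0"
    using AE_norm_control ne[of t1] ne[of t2]
  proof eventually_elim
    case (elim t)
    then show ?case using that ord by auto
  qed
  ultimately show ?thesis using ord ins unfolding \<Psi>_def by blast
qed

end

theorem theorem1p1: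
  fixes L :: landing and tf p0 :: real
    and r v u pr pv d :: "real \<Rightarrow> real^3" and m pm :: "real \<Rightarrow> real"
    and \<mu> :: "real measure"
  assumes "landing_data L"
    and "optimal L tf r v m u"
    and "pmp_multipliers L tf r v m u p0 pr pv pm \<mu>"
    and "thrust_direction L tf u pv d"
  shows "\<exists>t1 t2. 0 \<le> t1 \<and> t1 \<le> t2 \<and> t2 \<le> tf \<and>
    (AE t\<in>{0..<t1} \<union> {t2<..tf} in lebesgue. norm (u t) = lp_umax L) \<and>
    ((AE t\<in>{t1..t2} in lebesgue. norm (u t) = lp_umin L) \<or>
     (\<forall>t\<in>{t1..t2}. switching_function L m pv pm d t = 0))"
proof -
  interpret landing_extremal L tf p0 r v u pr pv d m pm \<mu>
    using assms by unfold_locales (auto simp: optimal_def)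
  show ?thesis by (rule max_min_max_or_max_singular_max)
qed

end
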